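(* Consider the deterministic pricing problem with expected sale constraints, with optimal value $v^*$, and the deterministic pricing problem with over-expected-sale penalties with parameters $\lambda\in\mathbb{R}^T_+$, with optimal value $v^\lambda$ and optimal solution $p^\lambda$ (see context). For any $\epsilon>0$: (i) For any $\lambda^1,\lambda^2\in\mathbb{R}^T_+$ such that $\lambda^1-\lambda^2=\epsilon\mathbf 1$, $$\sum_t\max\{0,(\alpha^t)^{\mathsf T}p^{\lambda^1}-r_t\}\le\sum_t\max\{0,(\alpha^t)^{\mathsf T}p^{\lambda^2}-r_t\}.$$ (ii) $v^\lambda\ge v^*$ for all $\lambda\in\mathbb{R}^T_+$, and if $\lambda_0:=\min_t\lambda_t\ge(\Delta^*-v^* )/\epsilon$, then $\sum_t\max\{0,(\alpha^t)^{\mathsf T}p^\lambda-r_t\}\le\epsilon$, where $\Delta^*=\max_x\Phi(x,a,b)$. (iii) Assume that there are positive constants $L_i,l_i$, $i\in\mathcal{V}$, such that $Y_i\partial G_i(Y)\le L_iY_i^{l_i}$ for all prices $x\ge0$. Then for any $\epsilon$ such that $$\epsilon\le\min_{t,i}\{\alpha^t_i:\alpha^t_i>0\}\cdot\min_t\left\{\frac{r_t}{(\alpha^t)^{\mathsf T}\mathbf 1}\right\},$$ if $\lambda_0\ge(\Delta^*-v^* )/\epsilon$, then $$|v^\lambda-v^*|\le\max\left\{\max_i\left\{\frac{a_i}{b_i}-\frac{1}{b_il_i}\log\frac{\delta(\epsilon)}{L_i}\right\},0\right\}\frac{m\epsilon}{\min_{t,i}\{\alpha^t_i:\alpha^t_i>0\}},$$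 where $\delta(\epsilon)=\min_t\left\{\frac{r_t}{(\alpha^t)^{\mathsf T}\mathbf 1}\right\}-\frac{\epsilon}{\min_{t,i}\{\alpha^t_i:\alpha^t_i>0\}}$, and this upper bound converges to zero linearly when $\epsilon$ tends to zero.
   Context: Products are $\mathcal{V}=\{1,\dots,m\}$ with costs $c\in\mathbb{R}^m$. A GEV choice probability generating function (CPGF) is a smooth function $G$ of vectors $Y$ with positive entries such that: (i) $G(Y)\ge 0$; (ii) $G(\lambda Y)=\lambda G(Y)$ for $\lambda>0$; (iii) $G(Y)\to\infty$ if $Y_i\to\infty$; (iv) for distinct $i_1,\dots,i_k$, the mixed partial derivative $\partial G_{i_1,\dots,i_k}(Y)$ is $>0$ if $k$ is odd and $\le 0$ if $k$ is even. (Consequently $G(Y)=\sum_i Y_i\partial G_i(Y)$ and $\sum_j Y_j\partial G_{ij}(Y)=0$ for all $i$.) The products are partitioned into nonempty disjoint $\mathcal{V}_1,\dots,\mathcal{V}_N$ with $G(Y)=\sum_nG^n(Y^n)$, $Y^n=(Y_i)_{i\in\mathcal{V}_n}$, each $G^n$ a CPGF; the choice parameters $(a,b)\in\mathbb{R}^{2m}$ are fixed, with $b_i>0$ and $b_i=b_j$ for $i,j$ in the same $\mathcal{V}_n$. For prices $x\in\mathbb{R}^m$: $Y_i=\exp(a_i-b_ix_i)$, purchase probabilities $p_i=Y_i\partial G_i(Y)/(1+G(Y))$, expected revenue $\Phi(x,a,b)=\sum_i(x_i-c_i)p_i$. Let $x(p|a,b,G)$ be the prices achieving purchase probabilities $p$,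 and $R(p)=\sum_{i}(x(p|a,b,G)_i-c_i)p_i$. Let $(\alpha^t,r_t)\in\mathbb{R}^m\times\mathbb{R}$, $t=1,\dots,T$, be parameters of expected sale constraints. Constrained problem: $v^*=\max\{R(p): p\ge0,\ \sum_ip_i\le1,\ (\alpha^t)^{\mathsf T}p\le r_t\ \forall t\}$. Penalized problem: $v^\lambda=\max\{R(p)-\sum_t\lambda_t\max\{0,(\alpha^t)^{\mathsf T}p-r_t\}:\ p\ge0,\ \sum_ip_i\le1\}$, with optimal solution $p^\lambda$. $\mathbf 1$ is the all-ones vector.
   Formalization: The inequality in (iii) is proved for costs c ≥ 0 and coefficients α^t ≥ 0, since it fails otherwise; R is taken only at p attained by finite prices, (ii) assumes such a feasible p exists, and the bound in (iii) is read as +∞ when δ(ε)=0. *)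

theory Defs
  imports "HOL-Analysis.Analysis"
begin

definition pos_orthant :: "(real^'v::finite) set" where
  "pos_orthant = {Y. \<forall>i. 0 < Y $ i}"

definition partial :: "'v \<Rightarrow> (real^'v::finite \<Rightarrow> real) \<Rightarrow> real^'v \<Rightarrow> real" where
  "partial i g Y = frechet_derivative g (at Y) (axis i 1)"

text \<open>\<open>partials [i1, ..., ik] g\<close> is the iterated partial derivative
  \<open>\<partial>\<^sub>i\<^sub>1 (... (\<partial>\<^sub>i\<^sub>k g))\<close>.\<close>
definition partials :: "'v list \<Rightarrow> (real^'v::finite \<Rightarrow> real) \<Rightarrow> real^'v \<Rightarrow> real" where
  "partials is g = foldr partial is g"

text \<open>\<open>C\<^sup>\<infinity>\<close> on the (open) positive orthant: all iterated partial derivatives are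
  differentiable there, and hence also continuous.\<close>
definition smooth_pos :: "(real^'v::finite \<Rightarrow> real) \<Rightarrow> bool" where
  "smooth_pos g \<longleftrightarrow> (\<forall>is. \<forall>Y\<in>pos_orthant. partials is g differentiable (at Y))"

text \<open>\<open>cpgf_on S g\<close>: \<open>g\<close> is a choice probability generating function of the subvector
  \<open>(Y\<^sub>i)\<^sub>i\<^sub>\<in>\<^sub>S\<close>.  A function of the subvector is represented by a function of the full vector
  whose values on the positive orthant depend on the coordinates in \<open>S\<close> only.  Values off
  the positive orthant are irrelevant.\<close>
definition cpgf_on :: "'v set \<Rightarrow> (real^'v::finite \<Rightarrow> real) \<Rightarrow> bool" where
  "cpgf_on S g \<longleftrightarrow>
     (\<forall>Y\<in>pos_orthant. \<forall>Z\<in>pos_orthant. (\<forall>i\<in>S. Y $ i = Z $ i) \<longrightarrow> g Y = g Z) \<and>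
     smooth_pos g \<and>
     (\<forall>Y\<in>pos_orthant. 0 \<le> g Y) \<and>
     (\<forall>Y\<in>pos_orthant. \<forall>s>0. g (s *\<^sub>R Y) = s * g Y) \<and>
     (\<forall>Y\<in>pos_orthant. \<forall>i\<in>S. filterlim (\<lambda>s. g (Y + s *\<^sub>R axis i 1)) at_top at_top) \<and>
     (\<forall>Y\<in>pos_orthant. \<forall>is. is \<noteq> [] \<and> distinct is \<and> set is \<subseteq> S \<longrightarrow>
        (odd (length is) \<longrightarrow> 0 < partials is g Y) \<and>
        (even (length is) \<longrightarrow> partials is g Y \<le> 0))"

text \<open>The products of each block \<open>V n\<close> share the price sensitivity \<open>b\<close>, and \<open>G\<close> is the
  sum of the block CPGFs.\<close>
definition partitioned_gev ::
  "('n::finite \<Rightarrow> 'v set) \<Rightarrow> ('n \<Rightarrow> real^'v::finite \<Rightarrow> real) \<Rightarrow> (real^'v \<Rightarrow> real) \<Rightarrow> real^'v \<Rightarrow> bool" where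
  "partitioned_gev V Gn G b \<longleftrightarrow>
     (\<forall>n. V n \<noteq> {}) \<and> disjoint_family V \<and> (\<Union>n. V n) = UNIV \<and>
     (\<forall>n. cpgf_on (V n) (Gn n)) \<and>
     (\<forall>Y\<in>pos_orthant. G Y = (\<Sum>n\<in>UNIV. Gn n Y)) \<and>
     (\<forall>i. 0 < b $ i) \<and>
     (\<forall>n. \<forall>i\<in>V n. \<forall>j\<in>V n. b $ i = b $ j)"

definition attraction :: "real^'v \<Rightarrow> real^'v \<Rightarrow> real^'v \<Rightarrow> real^'v::finite" where
  "attraction a b x = (\<chi> i. exp (a $ i - b $ i * x $ i))"

definition purchase_prob ::
  "(real^'v \<Rightarrow> real) \<Rightarrow> real^'v \<Rightarrow> real^'v \<Rightarrow> real^'v \<Rightarrow> real^'v::finite" where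
  "purchase_prob G a b x = (let Y = attraction a b x in (\<chi> i. Y $ i * partial i G Y / (1 + G Y)))"

definition expected_revenue ::
  "(real^'v::finite \<Rightarrow> real) \<Rightarrow> real^'v \<Rightarrow> real^'v \<Rightarrow> real^'v \<Rightarrow> real^'v \<Rightarrow> real" where
  "expected_revenue G a b c x = (\<Sum>i\<in>UNIV. (x $ i - c $ i) * purchase_prob G a b x $ i)"

definition prices ::
  "(real^'v \<Rightarrow> real) \<Rightarrow> real^'v \<Rightarrow> real^'v \<Rightarrow> real^'v \<Rightarrow> real^'v::finite" where
  "prices G a b p = inv (purchase_prob G a b) p"

definition revenue ::
  "(real^'v::finite \<Rightarrow> real) \<Rightarrow> real^'v \<Rightarrow> real^'v \<Rightarrow> real^'v \<Rightarrow> real^'v \<Rightarrow> real" where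
  "revenue G a b c p = (\<Sum>i\<in>UNIV. (prices G a b p $ i - c $ i) * p $ i)"

text \<open>The last condition says that \<open>prices\<close>, hence \<open>revenue\<close>, is defined at \<open>p\<close>.  (No finite
  price vector attains a \<open>p\<close> with some \<open>p\<^sub>i = 0\<close> or with \<open>\<Sum>\<^sub>i p\<^sub>i = 1\<close>.)\<close>
definition sale_probs ::
  "(real^'v::finite \<Rightarrow> real) \<Rightarrow> real^'v \<Rightarrow> real^'v \<Rightarrow> (real^'v) set" where
  "sale_probs G a b =
     {p. (\<forall>i. 0 \<le> p $ i) \<and> (\<Sum>i\<in>UNIV. p $ i) \<le> 1 \<and> p \<in> range (purchase_prob G a b)}"

definition constrained_probs ::
  "(real^'v::finite \<Rightarrow> real) \<Rightarrow> real^'v \<Rightarrow> real^'v \<Rightarrow> ('t \<Rightarrow> real^'v) \<Rightarrow> ('t \<Rightarrow> real) \<Rightarrow> (real^'v) set" where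
  "constrained_probs G a b \<alpha> r = {p \<in> sale_probs G a b. \<forall>t. \<alpha> t \<bullet> p \<le> r t}"

definition violation :: "('t \<Rightarrow> real^'v::finite) \<Rightarrow> ('t \<Rightarrow> real) \<Rightarrow> real^'v \<Rightarrow> 't \<Rightarrow> real" where
  "violation \<alpha> r p t = max 0 (\<alpha> t \<bullet> p - r t)"

definition total_violation ::
  "('t::finite \<Rightarrow> real^'v::finite) \<Rightarrow> ('t \<Rightarrow> real) \<Rightarrow> real^'v \<Rightarrow> real" where
  "total_violation \<alpha> r p = (\<Sum>t\<in>UNIV. violation \<alpha> r p t)"

definition penalized_revenue ::
  "(real^'v::finite \<Rightarrow> real) \<Rightarrow> real^'v \<Rightarrow> real^'v \<Rightarrow> real^'v \<Rightarrow> ('t::finite \<Rightarrow> real^'v) \<Rightarrow>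
     ('t \<Rightarrow> real) \<Rightarrow> real^'t \<Rightarrow> real^'v \<Rightarrow> real" where
  "penalized_revenue G a b c \<alpha> r l p =
     revenue G a b c p - (\<Sum>t\<in>UNIV. l $ t * violation \<alpha> r p t)"

definition constrained_value ::
  "(real^'v::finite \<Rightarrow> real) \<Rightarrow> real^'v \<Rightarrow> real^'v \<Rightarrow> real^'v \<Rightarrow> ('t \<Rightarrow> real^'v) \<Rightarrow> ('t \<Rightarrow> real) \<Rightarrow> real" where
  "constrained_value G a b c \<alpha> r = (SUP p\<in>constrained_probs G a b \<alpha> r. revenue G a b c p)"

definition penalized_value ::
  "(real^'v::finite \<Rightarrow> real) \<Rightarrow> real^'v \<Rightarrow> real^'v \<Rightarrow> real^'v \<Rightarrow> ('t::finite \<Rightarrow> real^'v) \<Rightarrow>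
     ('t \<Rightarrow> real) \<Rightarrow> real^'t \<Rightarrow> real" where
  "penalized_value G a b c \<alpha> r l = (SUP p\<in>sale_probs G a b. penalized_revenue G a b c \<alpha> r l p)"

definition penalized_optimal ::
  "(real^'v::finite \<Rightarrow> real) \<Rightarrow> real^'v \<Rightarrow> real^'v \<Rightarrow> real^'v \<Rightarrow> ('t::finite \<Rightarrow> real^'v) \<Rightarrow>
     ('t \<Rightarrow> real) \<Rightarrow> real^'t \<Rightarrow> real^'v \<Rightarrow> bool" where
  "penalized_optimal G a b c \<alpha> r l p \<longleftrightarrow>
     is_arg_max (penalized_revenue G a b c \<alpha> r l) (\<lambda>q. q \<in> sale_probs G a b) p"

definition unconstrained_value ::
  "(real^'v::finite \<Rightarrow> real) \<Rightarrow> real^'v \<Rightarrow> real^'v \<Rightarrow> real^'v \<Rightarrow> real" where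
  "unconstrained_value G a b c = (SUP x. expected_revenue G a b c x)"

definition min_pos_coeff :: "('t::finite \<Rightarrow> real^'v::finite) \<Rightarrow> real" where
  "min_pos_coeff \<alpha> = Min {\<alpha> t $ i | t i. 0 < \<alpha> t $ i}"

definition min_ratio :: "('t::finite \<Rightarrow> real^'v::finite) \<Rightarrow> ('t \<Rightarrow> real) \<Rightarrow> real" where
  "min_ratio \<alpha> r = Min (range (\<lambda>t. r t / (\<alpha> t \<bullet> 1)))"

definition slack :: "('t::finite \<Rightarrow> real^'v::finite) \<Rightarrow> ('t \<Rightarrow> real) \<Rightarrow> real \<Rightarrow> real" where
  "slack \<alpha> r \<epsilon> = min_ratio \<alpha> r - \<epsilon> / min_pos_coeff \<alpha>"

text \<open>The bound is extended-real because the logarithm of \<open>slack \<alpha> r \<epsilon>\<close> is to be read as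
  \<open>-\<infinity>\<close> when the slack is zero, whereas \<open>ln 0 = 0\<close> in HOL.\<close>
definition gap_bound ::
  "real^'v::finite \<Rightarrow> real^'v \<Rightarrow> ('v \<Rightarrow> real) \<Rightarrow> ('v \<Rightarrow> real) \<Rightarrow>
     ('t::finite \<Rightarrow> real^'v) \<Rightarrow> ('t \<Rightarrow> real) \<Rightarrow> real \<Rightarrow> ereal" where
  "gap_bound a b L l \<alpha> r \<epsilon> =
     (if slack \<alpha> r \<epsilon> \<le> 0 then \<infinity>
      else ereal
        (max (Max (range (\<lambda>i. a $ i / b $ i - 1 / (b $ i * l i) * ln (slack \<alpha> r \<epsilon> / L i)))) 0
         * (real CARD('v) * \<epsilon> / min_pos_coeff \<alpha>)))"

end

theory Submission
  imports Defs
begin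

text \<open>
  Let \<open>W = \<Sum>\<^sub>n G\<^sup>n / b\<^sub>n\<close>.  The sign conditions and homogeneity make the Hessians of \<open>G\<close> and
  \<open>W\<close> congruent to graph Laplacians, so both are convex, and the gradient of the convex
  function \<open>x \<mapsto> W (Y x)\<close> is \<open>- (1 + G (Y x)) p\<close>.  Its tangent inequality shows that lowering \<open>p\<close>
  componentwise to \<open>p'\<close> loses at most \<open>\<Sum>\<^sub>i (x'\<^sub>i - c\<^sub>i) (p\<^sub>i - p'\<^sub>i)\<close> of revenue, where \<open>x'\<close> are the
  prices at \<open>p'\<close>; applied to a feasible truncation of \<open>p\<^sup>\<lambda>\<close> this gives (iii).  Every \<open>p' > 0\<close> with
  \<open>\<Sum>\<^sub>i p'\<^sub>i < 1\<close> is attained by some prices, as the minimiser of a coercive function.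

  Parts (i) and (ii) follow by comparing optimal values, except when \<open>\<lambda>\<^sub>0 = 0\<close> in (ii).  Then
  \<open>v\<^sup>* = \<Delta>\<^sup>*\<close>, and one needs that the unconstrained optimum is unique and is approached by
  every maximising sequence: \<open>(\<Delta>\<^sup>* - \<Phi>(x)) (1 + G (Y x))\<close> dominates the Bregman divergence of
  \<open>x \<mapsto> W (Y x)\<close> from the prices \<open>c\<^sub>i + \<Delta>\<^sup>* + 1 / b\<^sub>i\<close>.
\<close>

section \<open>Partial derivatives on the positive orthant\<close>

lemma open_pos_orthant: "open (pos_orthant :: (real^'v::finite) set)"
proof -
  have "(pos_orthant :: (real^'v) set) = (\<Inter>i. {Y. 0 < Y $ i})"
    by (auto simp: pos_orthant_def)
  moreover have "open (\<Inter>i. {Y :: real^'v. 0 < Y $ i})"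
    by (intro open_INT ballI finite_class.finite_UNIV open_Collect_less continuous_intros)
  ultimately show ?thesis
    by metis
qed

lemma one_in_pos_orthant: "1 \<in> pos_orthant"
  by (simp add: pos_orthant_def)

lemma scale_in_pos_orthant: "Y \<in> pos_orthant \<Longrightarrow> 0 < s \<Longrightarrow> s *\<^sub>R Y \<in> pos_orthant"
  by (simp add: pos_orthant_def)

lemma segment_in_pos_orthant:
  assumes "Y \<in> pos_orthant" "Z \<in> pos_orthant" "0 \<le> s" "s \<le> 1"
  shows "Z + s *\<^sub>R (Y - Z) \<in> pos_orthant"
proof -
  have "0 < Z $ i + s * (Y $ i - Z $ i)" for i
  proof (cases "s = 0")
    case False
    have "Z $ i + s * (Y $ i - Z $ i) = (1 - s) * Z $ i + s * Y $ i"
      by (simp add: algebra_simps)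
    also have "0 < \<dots>"
      using assms False by (intro add_nonneg_pos) (auto simp: pos_orthant_def less_imp_le)
    finally show ?thesis .
  qed (use assms in \<open>simp add: pos_orthant_def\<close>)
  then show ?thesis
    by (simp add: pos_orthant_def)
qed

lemma partial_eqI: "(g has_derivative g') (at Y) \<Longrightarrow> partial i g Y = g' (axis i 1)"
  by (simp add: partial_def frechet_derivative_at[symmetric])

lemma has_derivative_partials:
  fixes g :: "real^'v::finite \<Rightarrow> real"
  assumes "g differentiable (at Y)"
  shows "(g has_derivative (\<lambda>h. \<Sum>i\<in>UNIV. h $ i * partial i g Y)) (at Y)"
proof -
  have d: "(g has_derivative frechet_derivative g (at Y)) (at Y)"
    using assms by (simp add: frechet_derivative_works)
  then interpret bounded_linear "frechet_derivative g (at Y)"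
    by (rule has_derivative_bounded_linear)
  have "frechet_derivative g (at Y) = (\<lambda>h. \<Sum>i\<in>UNIV. h $ i * partial i g Y)"
  proof
    fix h
    have "frechet_derivative g (at Y) h = frechet_derivative g (at Y) (\<Sum>i\<in>UNIV. h $ i *\<^sub>R axis i 1)"
      using basis_expansion[of h] by (simp add: scalar_mult_eq_scaleR)
    then show "frechet_derivative g (at Y) h = (\<Sum>i\<in>UNIV. h $ i * partial i g Y)"
      by (simp add: sum scaleR partial_def)
  qed
  with d show ?thesis
    by simp
qed

lemma has_real_derivative_along_line:
  fixes g :: "real^'v::finite \<Rightarrow> real"
  assumes "g differentiable (at (Y + s *\<^sub>R d))"
  shows "((\<lambda>s. g (Y + s *\<^sub>R d)) has_real_derivative
    (\<Sum>i\<in>UNIV. d $ i * partial i g (Y + s *\<^sub>R d))) (at s)"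
proof -
  have "((\<lambda>s. Y + s *\<^sub>R d) has_derivative (\<lambda>h. h *\<^sub>R d)) (at s)"
    by (auto intro!: derivative_eq_intros)
  from has_derivative_compose[OF this has_derivative_partials[OF assms]]
  show ?thesis
    by (rule has_derivative_imp_has_field_derivative) (simp add: sum_distrib_left mult_ac)
qed

text \<open>The orthant is open, so derivatives at its points ignore the values outside it, about
  which nothing is known.\<close>

lemma has_derivative_cong_pos_orthant:
  assumes "(f has_derivative f') (at Y)" "Y \<in> pos_orthant" "\<And>Z. Z \<in> pos_orthant \<Longrightarrow> f Z = g Z"
  shows "(g has_derivative f') (at Y)"
  using has_derivative_transform_within_open[OF assms(1) open_pos_orthant assms(2,3)] by blast

lemma differentiable_cong_pos_orthant:
  assumes "f differentiable (at Y)" "Y \<in> pos_orthant" "\<And>Z. Z \<in> pos_orthant \<Longrightarrow> f Z = g Z"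
  shows "g differentiable (at Y)" and "partial i g Y = partial i f Y"
proof -
  obtain f' where f': "(f has_derivative f') (at Y)"
    using assms(1) by (auto simp: differentiable_def)
  then have g: "(g has_derivative f') (at Y)"
    using assms(2,3) by (rule has_derivative_cong_pos_orthant)
  then show "g differentiable (at Y)"
    by (auto simp: differentiable_def)
  show "partial i g Y = partial i f Y"
    using partial_eqI[OF f'] partial_eqI[OF g] by simp
qed

section \<open>Homogeneous functions with nonpositive cross derivatives\<close>

text \<open>What \<open>G\<close> and \<open>W\<close> have in common: these hypotheses pass from
  the blocks to nonnegative combinations of them.\<close>

locale substitutable =
  fixes g :: "real^'v::finite \<Rightarrow> real"
  assumes differentiable: "Y \<in> pos_orthant \<Longrightarrow> g differentiable (at Y)"
    and partial_differentiable: "Y \<in> pos_orthant \<Longrightarrow> partial i g differentiable (at Y)"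
    and homogeneous: "Y \<in> pos_orthant \<Longrightarrow> 0 < s \<Longrightarrow> g (s *\<^sub>R Y) = s * g Y"
    and cross_partial_nonpos:
      "Y \<in> pos_orthant \<Longrightarrow> i \<noteq> j \<Longrightarrow> partial j (partial i g) Y \<le> 0"
begin

text \<open>Differentiate \<open>g (s *\<^sub>R Y) = s * g Y\<close> in \<open>Y\<close> and cancel
  \<open>s\<close>.\<close>

lemma partial_homogeneous:
  assumes "Y \<in> pos_orthant" "0 < s"
  shows "partial i g (s *\<^sub>R Y) = partial i g Y"
proof -
  have "((\<lambda>Y. s *\<^sub>R Y) has_derivative (\<lambda>h. s *\<^sub>R h)) (at Y)"
    by (auto intro!: derivative_eq_intros)
  from has_derivative_compose[OF this has_derivative_partials[OF differentiable]]
  have "((\<lambda>Y. g (s *\<^sub>R Y)) has_derivative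
      (\<lambda>h. \<Sum>i\<in>UNIV. (s *\<^sub>R h) $ i * partial i g (s *\<^sub>R Y))) (at Y)"
    using assms scale_in_pos_orthant by blast
  from has_derivative_cong_pos_orthant[OF this assms(1), of "\<lambda>Y. s * g Y"]
  have "((\<lambda>Y. s * g Y) has_derivative
      (\<lambda>h. \<Sum>i\<in>UNIV. (s *\<^sub>R h) $ i * partial i g (s *\<^sub>R Y))) (at Y)"
    using assms homogeneous by blast
  from partial_eqI[OF this]
  have "partial i (\<lambda>Y. s * g Y) Y = (\<Sum>j\<in>UNIV. (s *\<^sub>R axis i 1) $ j * partial j g (s *\<^sub>R Y))" .
  also have "\<dots> = s * partial i g (s *\<^sub>R Y)"
    by (simp add: axis_def if_distrib if_distribR cong: if_cong)
  finally have 1: "partial i (\<lambda>Y. s * g Y) Y = s * partial i g (s *\<^sub>R Y)" .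
  have "((\<lambda>Y. s * g Y) has_derivative (\<lambda>h. s * (\<Sum>i\<in>UNIV. h $ i * partial i g Y))) (at Y)"
    using has_derivative_partials[OF differentiable[OF assms(1)]]
    by (auto intro!: derivative_eq_intros)
  from partial_eqI[OF this]
  have "partial i (\<lambda>Y. s * g Y) Y = s * partial i g Y"
    by (simp add: axis_def if_distrib if_distribR cong: if_cong)
  with 1 assms(2) show ?thesis
    by simp
qed

text \<open>Both sides are the derivative of \<open>s \<mapsto> g (s *\<^sub>R Y)\<close> at 1; near
  \<open>s = 1\<close> the line through the origin stays in the orthant.\<close>

lemma euler:
  assumes "Y \<in> pos_orthant"
  shows "g Y = (\<Sum>i\<in>UNIV. Y $ i * partial i g Y)"
proof -
  have "((\<lambda>s. g (0 + s *\<^sub>R Y)) has_real_derivative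
      (\<Sum>i\<in>UNIV. Y $ i * partial i g (0 + 1 *\<^sub>R Y))) (at 1)"
    by (rule has_real_derivative_along_line) (simp add: differentiable assms)
  moreover have "((\<lambda>s. g (0 + s *\<^sub>R Y)) has_real_derivative g Y) (at 1)"
  proof (rule has_field_derivative_transform_within_open[where S = "{0<..}"])
    show "((\<lambda>s. s * g Y) has_real_derivative g Y) (at 1)"
      by (auto intro!: derivative_eq_intros)
  qed (use assms in \<open>auto simp: homogeneous\<close>)
  ultimately show ?thesis
    using DERIV_unique by fastforce
qed

text \<open>By homogeneity of degree zero, \<open>partial i g\<close> is constant along the ray
  through \<open>Y\<close>, so its radial derivative vanishes.\<close>

lemma sum_cross_partial_left:
  assumes "Y \<in> pos_orthant"
  shows "(\<Sum>j\<in>UNIV. Y $ j * partial j (partial i g) Y) = 0"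
proof -
  have "((\<lambda>s. partial i g (0 + s *\<^sub>R Y)) has_real_derivative
      (\<Sum>j\<in>UNIV. Y $ j * partial j (partial i g) (0 + 1 *\<^sub>R Y))) (at 1)"
    by (rule has_real_derivative_along_line) (simp add: partial_differentiable assms)
  moreover have "((\<lambda>s. partial i g (0 + s *\<^sub>R Y)) has_real_derivative 0) (at 1)"
  proof (rule has_field_derivative_transform_within_open[where S = "{0<..}"])
    show "((\<lambda>s. partial i g Y) has_real_derivative 0) (at 1)"
      by (auto intro!: derivative_eq_intros)
  qed (use assms in \<open>auto simp: partial_homogeneous\<close>)
  ultimately show ?thesis
    using DERIV_unique by fastforce
qed

text \<open>Differentiating Euler's identity; this spares us the symmetry of second derivatives.\<close>

lemma sum_cross_partial_right:
  assumes "Y \<in> pos_orthant"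
  shows "(\<Sum>i\<in>UNIV. Y $ i * partial j (partial i g) Y) = 0"
proof -
  have "((\<lambda>Y. \<Sum>i\<in>UNIV. Y $ i * partial i g Y) has_derivative
      (\<lambda>h. \<Sum>i\<in>UNIV. Y $ i * (\<Sum>k\<in>UNIV. h $ k * partial k (partial i g) Y) + h $ i * partial i g Y))
      (at Y)"
    by (intro has_derivative_sum has_derivative_mult has_derivative_partials partial_differentiable
        assms has_derivative_ident bounded_linear.has_derivative[OF bounded_linear_vec_nth])
  from partial_eqI[OF has_derivative_cong_pos_orthant[OF this assms, of g], of j]
  have "partial j g Y = (\<Sum>i\<in>UNIV. Y $ i * (\<Sum>k\<in>UNIV. axis j 1 $ k * partial k (partial i g) Y)
      + axis j 1 $ i * partial i g Y)"
    using euler by metis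
  also have "\<dots> = (\<Sum>i\<in>UNIV. Y $ i * partial j (partial i g) Y) + partial j g Y"
    unfolding sum.distrib by (simp add: axis_def if_distrib if_distribR cong: if_cong)
  finally show ?thesis
    by simp
qed

text \<open>The matrix \<open>Y\<^sub>i Y\<^sub>j \<partial>\<^sub>i\<^sub>j g\<close> has vanishing row and column sums and nonpositive
  off-diagonal entries, like a graph Laplacian.\<close>

lemma hessian_nonneg:
  assumes Y: "Y \<in> pos_orthant"
  shows "0 \<le> (\<Sum>i\<in>UNIV. \<Sum>j\<in>UNIV. z $ i * z $ j * partial j (partial i g) Y)"
proof -
  define e where "e i = z $ i / Y $ i" for i
  define w where "w i j = Y $ i * Y $ j * partial j (partial i g) Y" for i j
  have pos: "0 < Y $ i" for i
    using Y by (simp add: pos_orthant_def)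
  have z: "z $ i = Y $ i * e i" for i
    using pos[of i] by (simp add: e_def)
  have row: "(\<Sum>j\<in>UNIV. w i j) = 0" for i
    using sum_cross_partial_left[OF Y, of i]
    by (simp add: w_def sum_distrib_left[symmetric] mult.assoc)
  have col: "(\<Sum>i\<in>UNIV. w i j) = 0" for j
  proof -
    have "(\<Sum>i\<in>UNIV. w i j) = Y $ j * (\<Sum>i\<in>UNIV. Y $ i * partial j (partial i g) Y)"
      by (simp add: w_def sum_distrib_left mult_ac)
    then show ?thesis
      using sum_cross_partial_right[OF Y] by simp
  qed
  \<comment> \<open>Zero row and column sums remove the square terms, so the form is minus half the
    sum of \<open>w i j * (e i - e j)\<^sup>2\<close>, to which the diagonal does not
    contribute.\<close>
  have "(\<Sum>i\<in>UNIV. \<Sum>j\<in>UNIV. w i j * (e i)\<^sup>2) = 0"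
    by (simp add: row sum_distrib_right[symmetric])
  moreover have "(\<Sum>i\<in>UNIV. \<Sum>j\<in>UNIV. w i j * (e j)\<^sup>2) = 0"
    by (subst sum.swap) (simp add: col sum_distrib_right[symmetric])
  moreover have "w i j * (e i - e j)\<^sup>2 = w i j * (e i)\<^sup>2 + w i j * (e j)\<^sup>2 - 2 * (w i j * (e i * e j))" for i j
    by (simp add: power2_eq_square algebra_simps)
  ultimately have "(\<Sum>i\<in>UNIV. \<Sum>j\<in>UNIV. w i j * (e i - e j)\<^sup>2) =
      - 2 * (\<Sum>i\<in>UNIV. \<Sum>j\<in>UNIV. w i j * (e i * e j))"
    by (simp add: sum.distrib sum_subtractf sum_distrib_left[symmetric])
  moreover have "(\<Sum>i\<in>UNIV. \<Sum>j\<in>UNIV. w i j * (e i - e j)\<^sup>2) \<le> 0"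
  proof (intro sum_nonpos)
    fix i j
    show "w i j * (e i - e j)\<^sup>2 \<le> 0"
    proof (cases "i = j")
      case False
      then have "w i j \<le> 0"
        using pos cross_partial_nonpos[OF Y False] by (simp add: w_def mult_nonneg_nonpos less_imp_le)
      then show ?thesis
        by (simp add: mult_nonpos_nonneg)
    qed simp
  qed
  ultimately have "0 \<le> (\<Sum>i\<in>UNIV. \<Sum>j\<in>UNIV. w i j * (e i * e j))"
    by linarith
  then show ?thesis
    by (simp add: w_def z mult_ac)
qed

text \<open>By homogeneity this is convexity of \<open>g\<close>: the tangent plane at \<open>Y\<close> is linear.\<close>

lemma tangent_le:
  assumes Y: "Y \<in> pos_orthant" and Z: "Z \<in> pos_orthant"
  shows "(\<Sum>i\<in>UNIV. Z $ i * partial i g Y) \<le> g Z"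
proof -
  \<comment> \<open>\<open>W\<close> runs from \<open>Z\<close> to \<open>Y\<close>, and
    \<open>\<psi>\<close> evaluates at \<open>Z\<close> the linear form tangent at
    \<open>W s\<close>: \<open>\<psi> 0\<close> is \<open>g Z\<close> by Euler, and
    \<open>\<psi> 1\<close> is the left-hand side.\<close>
  define W where "W s = Z + s *\<^sub>R (Y - Z)" for s
  define \<psi> where "\<psi> s = (\<Sum>i\<in>UNIV. Z $ i * partial i g (W s))" for s
  have W: "W s \<in> pos_orthant" if "0 \<le> s" "s \<le> 1" for s
    using segment_in_pos_orthant[OF Y Z that] by (simp add: W_def)
  have deriv: "(\<psi> has_real_derivative
      (\<Sum>i\<in>UNIV. Z $ i * (\<Sum>j\<in>UNIV. (Y - Z) $ j * partial j (partial i g) (W s)))) (at s)"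
    if "0 \<le> s" "s \<le> 1" for s
    unfolding \<psi>_def W_def
    by (intro DERIV_sum DERIV_cmult has_real_derivative_along_line partial_differentiable)
       (use W[OF that] in \<open>simp add: W_def\<close>)
  have "\<psi> 1 \<le> \<psi> 0"
  proof (rule DERIV_nonpos_imp_decreasing_open[where f = \<psi>])
    fix s :: real assume s: "0 < s" "s < 1"
    then have Ws: "W s \<in> pos_orthant"
      using W by simp
    define H where "H i j = partial j (partial i g) (W s)" for i j
    \<comment> \<open>\<open>s\<close> times the direction is \<open>W s - Z\<close>, and
      \<open>H\<close> annihilates \<open>W s\<close>; what remains is minus the quadratic form at
      \<open>Z\<close>.\<close>
    have "s * (\<Sum>i\<in>UNIV. Z $ i * (\<Sum>j\<in>UNIV. (Y - Z) $ j * H i j)) =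
        (\<Sum>i\<in>UNIV. Z $ i * (\<Sum>j\<in>UNIV. (W s $ j - Z $ j) * H i j))"
      by (simp add: W_def sum_distrib_left mult_ac)
    also have "\<dots> = (\<Sum>i\<in>UNIV. Z $ i * (\<Sum>j\<in>UNIV. W s $ j * H i j)) -
        (\<Sum>i\<in>UNIV. \<Sum>j\<in>UNIV. Z $ i * Z $ j * H i j)"
      by (simp add: left_diff_distrib right_diff_distrib sum_subtractf sum_distrib_left mult_ac)
    also have "\<dots> \<le> 0"
      using hessian_nonneg[OF Ws] sum_cross_partial_left[OF Ws] by (simp add: H_def)
    finally have "(\<Sum>i\<in>UNIV. Z $ i * (\<Sum>j\<in>UNIV. (Y - Z) $ j * H i j)) \<le> 0"
      using s by (simp add: mult_le_0_iff)
    then show "\<exists>y. (\<psi> has_real_derivative y) (at s) \<and> y \<le> 0"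
      using deriv[of s] s unfolding H_def by auto
  next
    show "continuous_on {0..1} \<psi>"
      using DERIV_isCont[OF deriv] by (intro continuous_at_imp_continuous_on) auto
  qed simp
  then show ?thesis
    by (simp add: \<psi>_def W_def euler[OF Z])
qed

text \<open>From \<open>Z\<close> to \<open>Y\<close> only coordinates other than \<open>i\<close>
  grow, and in those directions the derivative of \<open>partial i g\<close> is nonpositive.\<close>

lemma partial_antimono:
  assumes Y: "Y \<in> pos_orthant" and Z: "Z \<in> pos_orthant"
    and le: "\<And>j. Z $ j \<le> Y $ j" and eq: "Z $ i = Y $ i"
  shows "partial i g Y \<le> partial i g Z"
proof -
  have "partial i g (Z + 1 *\<^sub>R (Y - Z)) \<le> partial i g (Z + 0 *\<^sub>R (Y - Z))"
  proof (rule DERIV_nonpos_imp_nonincreasing[where f = "\<lambda>s. partial i g (Z + s *\<^sub>R (Y - Z))"])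
    fix s :: real assume s: "0 \<le> s" "s \<le> 1"
    let ?W = "Z + s *\<^sub>R (Y - Z)"
    have W: "?W \<in> pos_orthant"
      using segment_in_pos_orthant[OF Y Z s] .
    have "(\<Sum>j\<in>UNIV. (Y - Z) $ j * partial j (partial i g) ?W) \<le> 0"
    proof (intro sum_nonpos)
      fix j
      show "(Y - Z) $ j * partial j (partial i g) ?W \<le> 0"
        using le[of j] eq cross_partial_nonpos[OF W, of i j]
        by (cases "i = j") (auto simp: mult_nonneg_nonpos)
    qed
    then show "\<exists>y. ((\<lambda>s. partial i g (Z + s *\<^sub>R (Y - Z))) has_real_derivative y) (at s) \<and> y \<le> 0"
      using has_real_derivative_along_line[OF partial_differentiable[OF W]] by blast
  qed simp
  then show ?thesis
    by simp
qed

end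

section \<open>Choice probability generating functions\<close>

lemma has_real_derivative_partial:
  fixes g :: "real^'v::finite \<Rightarrow> real"
  assumes "g differentiable (at Y)"
  shows "((\<lambda>s. g (Y + s *\<^sub>R axis i 1)) has_real_derivative partial i g Y) (at 0)"
  using has_real_derivative_along_line[of g Y 0 "axis i 1"] assms
  by (simp add: axis_def if_distrib if_distribR cong: if_cong)

lemma add_axis_in_pos_orthant:
  assumes "Y \<in> pos_orthant" "\<bar>s\<bar> < Y $ i"
  shows "Y + s *\<^sub>R axis i 1 \<in> pos_orthant"
  using assms by (auto simp: pos_orthant_def axis_def)

text \<open>Equal small shifts along one axis keep \<open>Y\<close> and \<open>Z\<close> in the
  orthant and in agreement on \<open>S\<close>, so both sides differentiate the same function of
  \<open>s\<close>.\<close>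

lemma partial_eq_if_depends_only_on:
  fixes g :: "real^'v::finite \<Rightarrow> real"
  assumes diff: "\<And>Y. Y \<in> pos_orthant \<Longrightarrow> g differentiable (at Y)"
    and dep: "\<And>Y Z. Y \<in> pos_orthant \<Longrightarrow> Z \<in> pos_orthant \<Longrightarrow> \<forall>i\<in>S. Y $ i = Z $ i \<Longrightarrow> g Y = g Z"
    and Y: "Y \<in> pos_orthant" and Z: "Z \<in> pos_orthant" and eq: "\<forall>i\<in>S. Y $ i = Z $ i"
  shows "partial i g Y = partial i g Z"
proof -
  define \<rho> where "\<rho> = min (Y $ i) (Z $ i)"
  have "((\<lambda>s. g (Z + s *\<^sub>R axis i 1)) has_real_derivative partial i g Y) (at 0)"
  proof (rule has_field_derivative_transform_within_open[OF has_real_derivative_partial[OF diff[OF Y]]])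
    show "open {-\<rho><..<\<rho>}" and "0 \<in> {-\<rho><..<\<rho>}"
      using Y Z by (auto simp: \<rho>_def pos_orthant_def)
    fix s assume "s \<in> {-\<rho><..<\<rho>}"
    then have "\<bar>s\<bar> < Y $ i" "\<bar>s\<bar> < Z $ i"
      by (auto simp: \<rho>_def)
    then show "g (Y + s *\<^sub>R axis i 1) = g (Z + s *\<^sub>R axis i 1)"
      using Y Z eq by (intro dep add_axis_in_pos_orthant) auto
  qed
  then show ?thesis
    using has_real_derivative_partial[OF diff[OF Z]] DERIV_unique by blast
qed

lemma partial_eq_0_if_depends_only_on:
  fixes g :: "real^'v::finite \<Rightarrow> real"
  assumes diff: "g differentiable (at Y)" and Y: "Y \<in> pos_orthant"
    and dep: "\<And>Z. Z \<in> pos_orthant \<Longrightarrow> \<forall>i\<in>S. Y $ i = Z $ i \<Longrightarrow> g Y = g Z"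
    and i: "i \<notin> S"
  shows "partial i g Y = 0"
proof -
  have "((\<lambda>s. g Y) has_real_derivative partial i g Y) (at 0)"
  proof (rule has_field_derivative_transform_within_open[OF has_real_derivative_partial[OF diff]])
    show "open {- Y $ i<..<Y $ i}" and "0 \<in> {- Y $ i<..<Y $ i}"
      using Y by (auto simp: pos_orthant_def)
    fix s assume "s \<in> {- Y $ i<..<Y $ i}"
    then have "\<bar>s\<bar> < Y $ i"
      by auto
    then have "g Y = g (Y + s *\<^sub>R axis i 1)"
      using Y i by (intro dep add_axis_in_pos_orthant) (auto simp: axis_def)
    then show "g (Y + s *\<^sub>R axis i 1) = g Y" ..
  qed
  then show ?thesis
    using DERIV_unique DERIV_const by blast
qed

lemma smooth_pos_differentiable:
  assumes "smooth_pos g" "Y \<in> pos_orthant"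
  shows "g differentiable (at Y)" and "partial i g differentiable (at Y)"
proof -
  have "partials is g differentiable (at Y)" for "is"
    using assms by (auto simp: smooth_pos_def)
  from this[of "[]"] this[of "[i]"]
  show "g differentiable (at Y)" and "partial i g differentiable (at Y)"
    by (simp_all add: partials_def)
qed

context
  fixes S :: "'v::finite set" and g :: "real^'v \<Rightarrow> real"
  assumes cpgf: "cpgf_on S g"
begin

lemma cpgf_on_smooth: "smooth_pos g"
  using cpgf unfolding cpgf_on_def by blast

lemma cpgf_on_depends:
  "Y \<in> pos_orthant \<Longrightarrow> Z \<in> pos_orthant \<Longrightarrow> \<forall>i\<in>S. Y $ i = Z $ i \<Longrightarrow> g Y = g Z"
  using cpgf unfolding cpgf_on_def by blast

lemma cpgf_on_partial_eq_0:
  assumes "Y \<in> pos_orthant" "i \<notin> S"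
  shows "partial i g Y = 0"
  using smooth_pos_differentiable(1)[OF cpgf_on_smooth assms(1)] assms(1)
    cpgf_on_depends[OF assms(1)] assms(2)
  by (rule partial_eq_0_if_depends_only_on)

lemma cpgf_on_mixed:
  assumes "Y \<in> pos_orthant" "is \<noteq> []" "distinct is" "set is \<subseteq> S"
  shows "odd (length is) \<Longrightarrow> 0 < partials is g Y" and "even (length is) \<Longrightarrow> partials is g Y \<le> 0"
proof -
  have "\<forall>Y\<in>pos_orthant. \<forall>is. is \<noteq> [] \<and> distinct is \<and> set is \<subseteq> S \<longrightarrow>
      (odd (length is) \<longrightarrow> 0 < partials is g Y) \<and> (even (length is) \<longrightarrow> partials is g Y \<le> 0)"
    using cpgf unfolding cpgf_on_def by (elim conjE)
  then show "odd (length is) \<Longrightarrow> 0 < partials is g Y" and "even (length is) \<Longrightarrow> partials is g Y \<le> 0"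
    using assms by blast+
qed

lemma cpgf_on_partial_pos:
  assumes "Y \<in> pos_orthant" "i \<in> S"
  shows "0 < partial i g Y"
  using cpgf_on_mixed(1)[of Y "[i]"] assms by (simp add: partials_def)

text \<open>\<open>cpgf_on\<close> gives signs only for indices in \<open>S\<close>. If
  \<open>i\<close> lies outside, \<open>partial i g\<close> vanishes on the orthant; if
  \<open>j\<close> does, \<open>partial i g\<close> still depends on \<open>S\<close> alone, so its
  derivative in direction \<open>j\<close> is zero.\<close>

lemma cpgf_on_substitutable: "substitutable g"
proof
  fix Y :: "real^'v" assume Y: "Y \<in> pos_orthant"
  show "g differentiable (at Y)" "partial i g differentiable (at Y)" for i
    using smooth_pos_differentiable[OF cpgf_on_smooth Y] by auto
  show "g (s *\<^sub>R Y) = s * g Y" if "0 < s" for s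
    using cpgf Y that unfolding cpgf_on_def by blast
  show "partial j (partial i g) Y \<le> 0" if "i \<noteq> j" for i j
  proof (cases "i \<in> S \<and> j \<in> S")
    case True
    then show ?thesis
      using cpgf_on_mixed(2)[of Y "[j, i]"] Y that by (simp add: partials_def)
  next
    case False
    consider "i \<notin> S" | "j \<notin> S"
      using False by blast
    then have "partial j (partial i g) Y = 0"
    proof cases
      case 1
      have "partial j (partial i g) Y = partial j (\<lambda>_. 0) Y"
        by (rule differentiable_cong_pos_orthant) (use Y 1 cpgf_on_partial_eq_0 in auto)
      also have "\<dots> = 0"
        by (simp add: partial_eqI[OF has_derivative_const])
      finally show ?thesis .
    next
      case 2
      have "partial i g Y = partial i g Z" if "Z \<in> pos_orthant" "\<forall>k\<in>S. Y $ k = Z $ k" for Z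
        using smooth_pos_differentiable(1)[OF cpgf_on_smooth] cpgf_on_depends Y that
        by (rule partial_eq_if_depends_only_on)
      from partial_eq_0_if_depends_only_on[OF smooth_pos_differentiable(2)[OF cpgf_on_smooth Y] Y this 2]
      show ?thesis .
    qed
    then show ?thesis
      by simp
  qed
qed

end

section \<open>Weighted sums of block functions\<close>

lemma partial_weighted_sum:
  fixes h :: "'n::finite \<Rightarrow> real^'v::finite \<Rightarrow> real"
  assumes "\<And>n. h n differentiable (at Y)" and Y: "Y \<in> pos_orthant"
    and F: "\<And>Z. Z \<in> pos_orthant \<Longrightarrow> F Z = (\<Sum>n\<in>UNIV. w n * h n Z)"
  shows "F differentiable (at Y)" and "partial i F Y = (\<Sum>n\<in>UNIV. w n * partial i (h n) Y)"
proof -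
  have "((\<lambda>Z. \<Sum>n\<in>UNIV. w n * h n Z) has_derivative
      (\<lambda>d. \<Sum>n\<in>UNIV. w n * (\<Sum>k\<in>UNIV. d $ k * partial k (h n) Y))) (at Y)"
    by (intro has_derivative_sum has_derivative_mult_right has_derivative_partials assms(1))
  then have *: "(F has_derivative (\<lambda>d. \<Sum>n\<in>UNIV. w n * (\<Sum>k\<in>UNIV. d $ k * partial k (h n) Y))) (at Y)"
    by (rule has_derivative_cong_pos_orthant) (simp_all add: Y F)
  then show "F differentiable (at Y)"
    by (auto simp: differentiable_def)
  show "partial i F Y = (\<Sum>n\<in>UNIV. w n * partial i (h n) Y)"
    using partial_eqI[OF *] by (simp add: axis_def if_distrib if_distribR cong: if_cong)
qed

text \<open>Differentiation is linear, and nonnegative weights preserve the sign of the cross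
  derivatives.\<close>

lemma substitutable_weighted_sum:
  fixes h :: "'n::finite \<Rightarrow> real^'v::finite \<Rightarrow> real"
  assumes h: "\<And>n. substitutable (h n)" and w: "\<And>n. 0 \<le> w n"
    and F: "\<And>Y. Y \<in> pos_orthant \<Longrightarrow> F Y = (\<Sum>n\<in>UNIV. w n * h n Y)"
  shows "substitutable F"
proof
  fix Y :: "real^'v" assume Y: "Y \<in> pos_orthant"
  have hd: "h n differentiable (at Z)" "partial i (h n) differentiable (at Z)"
    if "Z \<in> pos_orthant" for n i Z
    using substitutable.differentiable[OF h that] substitutable.partial_differentiable[OF h that] by auto
  have pF: "partial i F Z = (\<Sum>n\<in>UNIV. w n * partial i (h n) Z)" if "Z \<in> pos_orthant" for i Z
    using partial_weighted_sum(2)[of h Z F w] hd that F by blast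
  show "F differentiable (at Y)"
    using partial_weighted_sum(1)[of h Y F w] hd Y F by blast
  show "partial i F differentiable (at Y)" for i
    using partial_weighted_sum(1)[of "\<lambda>n. partial i (h n)" Y "partial i F" w] hd Y pF by blast
  show "F (s *\<^sub>R Y) = s * F Y" if "0 < s" for s
    using that Y by (simp add: F scale_in_pos_orthant substitutable.homogeneous[OF h] sum_distrib_left mult_ac)
  show "partial j (partial i F) Y \<le> 0" if "i \<noteq> j" for i j
  proof -
    have "partial j (partial i F) Y = (\<Sum>n\<in>UNIV. w n * partial j (partial i (h n)) Y)"
      using partial_weighted_sum(2)[of "\<lambda>n. partial i (h n)" Y "partial i F" w] hd Y pF by blast
    also have "\<dots> \<le> 0"
      by (intro sum_nonpos mult_nonneg_nonpos w substitutable.cross_partial_nonpos[OF h] Y that)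
    finally show ?thesis .
  qed
qed

section \<open>Purchase probabilities and expected revenue\<close>

text \<open>Squaring the weak inequality at \<open>t / 2\<close> gains \<open>t\<^sup>2 / 4\<close>.
  The strictness later makes the unconstrained optimum unique.\<close>

lemma exp_gt_tangent:
  fixes t :: real
  assumes "t \<noteq> 0"
  shows "1 + t < exp t"
proof (cases "0 \<le> 1 + t / 2")
  case True
  have "1 + t < (1 + t / 2)\<^sup>2"
    using assms zero_less_power2[of t] by (simp add: power2_eq_square field_simps)
  also have "\<dots> \<le> (exp (t / 2))\<^sup>2"
    using True by (intro power_mono exp_ge_add_one_self)
  also have "\<dots> = exp t"
    by (simp add: power2_eq_square exp_add[symmetric])
  finally show ?thesis .
next
  case False
  then show ?thesis
    using exp_gt_zero[of t] by linarith
qed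

lemma abs_le_exp_plus_linear:
  fixes k w :: real
  assumes k: "0 < k" and w: "0 < w"
  obtains C where "\<And>t. w * \<bar>t\<bar> \<le> k * exp (- t) + w * t + C"
proof
  \<comment> \<open>At \<open>t = - s\<close> the tangent to \<open>k * exp (- t)\<close> has slope
    \<open>- 2 * w\<close>, so adding \<open>w * t\<close> still leaves slope \<open>- w\<close> for
    negative \<open>t\<close>.\<close>
  define s where "s = ln (2 * w / k)"
  have s: "k * exp s = 2 * w"
    using assms by (simp add: s_def)
  fix t :: real
  show "w * \<bar>t\<bar> \<le> k * exp (- t) + w * t + 2 * w * \<bar>1 - s\<bar>"
  proof (cases "0 \<le> t")
    case True
    have "0 \<le> k * exp (- t)" "0 \<le> 2 * w * \<bar>1 - s\<bar>"
      using assms by simp_all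
    then show ?thesis
      using True by (simp add: algebra_simps)
  next
    case False
    have "2 * w * (1 + (- t - s)) \<le> 2 * w * exp (- t - s)"
      using w by (intro mult_left_mono exp_ge_add_one_self) auto
    also have "\<dots> = k * exp s * exp (- t - s)"
      by (simp add: s)
    also have "\<dots> = k * exp (- t)"
      by (simp add: exp_add[symmetric] mult.assoc)
    finally have "2 * w * (1 - s) - 2 * w * t \<le> k * exp (- t)"
      by (simp add: algebra_simps)
    moreover have "2 * w * - (1 - s) \<le> 2 * w * \<bar>1 - s\<bar>"
      using w by (intro mult_left_mono) auto
    ultimately have "- (w * t) \<le> k * exp (- t) + w * t + 2 * w * \<bar>1 - s\<bar>"
      by (simp add: algebra_simps)
    then show ?thesis
      using False by simp
  qed
qed

text \<open>\<open>W\<close> stands for \<open>\<Sum>\<^sub>n G\<^sup>n / b\<^sub>n\<close>, where \<open>b\<^sub>n\<close> is the price sensitivity of block \<open>n\<close>.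
  Up to sign, the gradient of \<open>x \<mapsto> W (Y x)\<close> is \<open>(1 + G (Y x)) \<cdot> p x\<close>.\<close>

locale gev_pricing =
  G: substitutable G + W: substitutable W for G W :: "real^'v::finite \<Rightarrow> real" +
  fixes a b c :: "real^'v"
  assumes b_pos: "0 < b $ i"
    and partial_pos: "Y \<in> pos_orthant \<Longrightarrow> 0 < partial i G Y"
    and partial_W: "Y \<in> pos_orthant \<Longrightarrow> partial i W Y = partial i G Y / b $ i"
begin

abbreviation Y :: "real^'v \<Rightarrow> real^'v" where
  "Y \<equiv> attraction a b"

abbreviation p :: "real^'v \<Rightarrow> real^'v" where
  "p \<equiv> purchase_prob G a b"

text \<open>The unnormalised purchase probability, on the scale where no purchase has weight
  1.\<close>

definition weight :: "real^'v \<Rightarrow> 'v \<Rightarrow> real" where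
  "weight x i = Y x $ i * partial i G (Y x)"

lemma Y_nth: "Y x $ i = exp (a $ i - b $ i * x $ i)"
  by (simp add: attraction_def)

lemma Y_pos: "Y x \<in> pos_orthant"
  by (simp add: pos_orthant_def Y_nth)

lemma Y_change: "Y z $ i = Y x $ i * exp (b $ i * (x $ i - z $ i))"
  by (simp add: Y_nth exp_add[symmetric] algebra_simps)

lemma weight_pos: "0 < weight x i"
  using partial_pos[OF Y_pos] by (simp add: weight_def Y_nth)

lemma G_eq: "G (Y x) = (\<Sum>i\<in>UNIV. weight x i)"
  using G.euler[OF Y_pos] by (simp add: weight_def)

lemma W_eq: "W (Y x) = (\<Sum>i\<in>UNIV. weight x i / b $ i)"
  using W.euler[OF Y_pos] partial_W[OF Y_pos] by (simp add: weight_def)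

lemma G_pos: "0 < G (Y x)"
  unfolding G_eq by (intro sum_pos weight_pos) auto

lemma p_nth: "p x $ i = weight x i / (1 + G (Y x))"
  by (simp add: purchase_prob_def Let_def weight_def)

lemma p_pos: "0 < p x $ i"
  using weight_pos[of x i] G_pos[of x] by (simp add: p_nth)

lemma sum_p: "(\<Sum>i\<in>UNIV. p x $ i) = 1 - 1 / (1 + G (Y x))"
  using G_pos[of x] by (simp add: p_nth sum_divide_distrib[symmetric] G_eq[symmetric] field_simps)

lemma sum_p_less_1: "(\<Sum>i\<in>UNIV. p x $ i) < 1"
  using G_pos[of x] by (simp add: sum_p)

lemma p_le_weight: "p x $ i \<le> weight x i"
proof -
  have "weight x i * 1 \<le> weight x i * (1 + G (Y x))"
    using weight_pos[of x i] G_pos[of x] by (intro mult_left_mono) auto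
  then show ?thesis
    using G_pos[of x] by (simp add: p_nth divide_le_eq)
qed

text \<open>The tangent inequality at \<open>Y x\<close>, evaluated at the all-ones vector, bounds
  each partial derivative of \<open>G\<close> by \<open>G 1\<close>.\<close>

lemma weight_le: "weight x i \<le> G 1 * Y x $ i"
proof -
  have "partial i G (Y x) \<le> (\<Sum>i\<in>UNIV. 1 $ i * partial i G (Y x))"
    using member_le_sum[of i UNIV "\<lambda>i. partial i G (Y x)"] partial_pos[OF Y_pos] by (simp add: less_imp_le)
  also have "\<dots> \<le> G 1"
    by (rule G.tangent_le[OF Y_pos one_in_pos_orthant])
  finally show ?thesis
    by (simp add: weight_def Y_nth)
qed

lemma G_1_pos: "0 < G 1"
proof -
  have "0 < (\<Sum>i\<in>(UNIV :: 'v set). 1 $ i * partial i G 1)"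
    by (intro sum_pos) (auto simp: partial_pos one_in_pos_orthant)
  then show ?thesis
    using G.euler[OF one_in_pos_orthant] by simp
qed

section \<open>Continuity in the prices\<close>

lemma continuous_on_Y: "continuous_on UNIV Y"
  unfolding attraction_def by (intro continuous_intros)

lemma continuous_on_compose_Y:
  assumes "\<And>Z. Z \<in> pos_orthant \<Longrightarrow> g differentiable (at Z)"
  shows "continuous_on UNIV (\<lambda>x. g (Y x))"
proof (rule continuous_on_compose2[OF _ continuous_on_Y])
  show "continuous_on pos_orthant g"
    by (intro continuous_at_imp_continuous_on ballI differentiable_imp_continuous_within assms)
  show "range Y \<subseteq> pos_orthant"
    using Y_pos by blast
qed

lemma continuous_on_G_Y: "continuous_on UNIV (\<lambda>x. G (Y x))"
  by (rule continuous_on_compose_Y) (rule G.differentiable)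

lemma continuous_on_W_Y: "continuous_on UNIV (\<lambda>x. W (Y x))"
  by (rule continuous_on_compose_Y) (rule W.differentiable)

lemma continuous_on_weight: "continuous_on UNIV (\<lambda>x. weight x i)"
  unfolding weight_def
  by (intro continuous_intros continuous_on_compose_Y G.partial_differentiable continuous_on_Y)

lemma continuous_on_p: "continuous_on UNIV p"
proof -
  have "continuous_on UNIV (\<lambda>x. \<chi> i. weight x i / (1 + G (Y x)))"
    using G_pos by (intro continuous_intros continuous_on_weight continuous_on_G_Y)
      (metis add_pos_pos less_numeral_extra(1,3))
  moreover have "p = (\<lambda>x. \<chi> i. weight x i / (1 + G (Y x)))"
    by (simp add: fun_eq_iff vec_eq_iff p_nth)
  ultimately show ?thesis
    by simp
qed

text \<open>Convexity of \<open>x \<mapsto> W (Y x)\<close>, by two tangent inequalities: that of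
  \<open>exp\<close> in each coordinate and that of \<open>W\<close>. The factor
  \<open>1 / b $ i\<close> in \<open>W\<close> cancels the inner derivative, so the gradient is
  minus \<open>weight\<close>.\<close>

lemma W_Y_tangent: "W (Y x) + (\<Sum>i\<in>UNIV. weight x i * (x $ i - z $ i)) \<le> W (Y z)"
proof -
  have "weight x i / b $ i + weight x i * (x $ i - z $ i) \<le> Y z $ i * partial i W (Y x)" for i
  proof -
    have "weight x i / b $ i * (1 + b $ i * (x $ i - z $ i)) \<le>
        weight x i / b $ i * exp (b $ i * (x $ i - z $ i))"
      using weight_pos[of x i] b_pos[of i] by (intro mult_left_mono exp_ge_add_one_self) auto
    then show ?thesis
      using b_pos[of i]
      by (simp add: weight_def partial_W[OF Y_pos] Y_change[of z i x] distrib_left add_divide_distrib mult_ac)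
  qed
  then have "(\<Sum>i\<in>UNIV. weight x i / b $ i + weight x i * (x $ i - z $ i)) \<le>
      (\<Sum>i\<in>UNIV. Y z $ i * partial i W (Y x))"
    by (intro sum_mono)
  also have "\<dots> \<le> W (Y z)"
    by (rule W.tangent_le[OF Y_pos Y_pos])
  finally show ?thesis
    by (simp add: W_eq[of x] sum.distrib)
qed

section \<open>Sale probabilities and finiteness of the optimal values\<close>

lemma p_in_sale_probs: "p x \<in> sale_probs G a b"
  using p_pos[of x] sum_p_less_1[of x] by (simp add: sale_probs_def less_imp_le)

lemma p_prices: "q \<in> sale_probs G a b \<Longrightarrow> p (prices G a b q) = q"
  by (auto simp: sale_probs_def prices_def f_inv_into_f)

lemma revenue_eq_expected_revenue:
  "q \<in> sale_probs G a b \<Longrightarrow> revenue G a b c q = expected_revenue G a b c (prices G a b q)"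
  by (simp add: revenue_def expected_revenue_def p_prices)

text \<open>A negative margin earns nothing; for a margin \<open>t \<ge> 0\<close> the probability
  decays like \<open>exp (- (b $ i * t))\<close>, and \<open>u * exp (- u) \<le> 1\<close>.\<close>

lemma expected_revenue_le:
  "expected_revenue G a b c x \<le> (\<Sum>i\<in>UNIV. G 1 * exp (a $ i - b $ i * c $ i) / b $ i)"
  unfolding expected_revenue_def
proof (intro sum_mono)
  fix i
  define t where "t = x $ i - c $ i"
  have b: "0 < b $ i"
    by (rule b_pos)
  show "(x $ i - c $ i) * p x $ i \<le> G 1 * exp (a $ i - b $ i * c $ i) / b $ i"
  proof (cases "0 \<le> t")
    case True
    have "p x $ i \<le> G 1 * (exp (a $ i - b $ i * c $ i) * exp (- (b $ i * t)))"
      using order_trans[OF p_le_weight weight_le, of x i]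
      by (simp add: Y_nth t_def exp_add[symmetric] algebra_simps)
    then have "t * p x $ i \<le> t * (G 1 * (exp (a $ i - b $ i * c $ i) * exp (- (b $ i * t))))"
      using True by (rule mult_left_mono)
    also have "\<dots> = G 1 * exp (a $ i - b $ i * c $ i) / b $ i * (b $ i * t * exp (- (b $ i * t)))"
      using b by simp
    also have "\<dots> \<le> G 1 * exp (a $ i - b $ i * c $ i) / b $ i * 1"
    proof (rule mult_left_mono)
      have "b $ i * t \<le> exp (b $ i * t)"
        using exp_ge_add_one_self[of "b $ i * t"] by linarith
      then show "b $ i * t * exp (- (b $ i * t)) \<le> 1"
        by (simp add: exp_minus field_simps)
    qed (use G_1_pos b in simp)
    finally show ?thesis
      by (simp add: t_def)
  next
    case False
    then have "t * p x $ i \<le> 0"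
      using p_pos[of x i] by (intro mult_nonpos_nonneg) auto
    also have "0 \<le> G 1 * exp (a $ i - b $ i * c $ i) / b $ i"
      using G_1_pos b by simp
    finally show ?thesis
      by (simp add: t_def)
  qed
qed

lemma bdd_above_expected_revenue: "bdd_above (range (expected_revenue G a b c))"
  by (rule bdd_aboveI2) (rule expected_revenue_le)

lemma expected_revenue_le_unconstrained:
  "expected_revenue G a b c x \<le> unconstrained_value G a b c"
  unfolding unconstrained_value_def by (intro cSUP_upper bdd_above_expected_revenue) simp

lemma revenue_le_unconstrained:
  "q \<in> sale_probs G a b \<Longrightarrow> revenue G a b c q \<le> unconstrained_value G a b c"
  by (simp add: revenue_eq_expected_revenue expected_revenue_le_unconstrained)

subsection \<open>Purchase probabilities attained by finite prices\<close>

text \<open>The prices are the minimiser of the coercive function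
  \<open>x \<mapsto> G (Y x) + \<Sum>\<^sub>i w\<^sub>i b\<^sub>i x\<^sub>i\<close>, whose critical points satisfy \<open>Y\<^sub>i \<partial>\<^sub>i G (Y) = w\<^sub>i\<close>.\<close>

lemma ex_weight_eq:
  assumes w: "\<And>i. 0 < w i"
  obtains x where "\<And>i. weight x i = w i"
proof -
  define h where "h x = G (Y x) + (\<Sum>i\<in>UNIV. w i * (b $ i * x $ i))" for x
  \<comment> \<open>The tangent of \<open>G\<close> at the all-ones vector bounds
    \<open>G (Y x)\<close> below by the sum of \<open>k i * exp (- (b $ i * x $ i))\<close>, which
    separates the coordinates.\<close>
  define k where "k i = partial i G 1 * exp (a $ i)" for i
  have k: "0 < k i" for i
    using partial_pos[OF one_in_pos_orthant] by (simp add: k_def)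
  have "\<exists>C. \<forall>t. w i * \<bar>t\<bar> \<le> k i * exp (- t) + w i * t + C" for i
    using abs_le_exp_plus_linear[OF k w] by metis
  then obtain C where C: "\<And>i t. w i * \<bar>t\<bar> \<le> k i * exp (- t) + w i * t + C i"
    by metis
  have coercive: "(\<Sum>i\<in>UNIV. w i * b $ i * \<bar>x $ i\<bar>) \<le> h x + (\<Sum>i\<in>UNIV. C i)" for x
  proof -
    have "w i * b $ i * \<bar>x $ i\<bar> \<le> Y x $ i * partial i G 1 + w i * (b $ i * x $ i) + C i" for i
      using C[of i "b $ i * x $ i"] b_pos[of i]
      by (simp add: Y_nth k_def abs_mult exp_diff exp_minus field_simps)
    then have "(\<Sum>i\<in>UNIV. w i * b $ i * \<bar>x $ i\<bar>) \<le>
        (\<Sum>i\<in>UNIV. Y x $ i * partial i G 1 + w i * (b $ i * x $ i) + C i)"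
      by (intro sum_mono)
    also have "\<dots> \<le> h x + (\<Sum>i\<in>UNIV. C i)"
      using G.tangent_le[OF one_in_pos_orthant Y_pos] by (simp add: h_def sum.distrib)
    finally show ?thesis .
  qed
  define S where "S = {x. h x \<le> h 0}"
  have cont: "continuous_on UNIV h"
    unfolding h_def by (intro continuous_intros continuous_on_G_Y)
  have "compact S"
  proof (rule compact_eq_bounded_closed[THEN iffD2, OF conjI])
    show "closed S"
      unfolding S_def by (intro closed_Collect_le cont continuous_on_const)
    define B where "B = h 0 + (\<Sum>i\<in>UNIV. C i)"
    have "norm x \<le> (\<Sum>i\<in>UNIV. B / (w i * b $ i))" if "x \<in> S" for x
    proof -
      have "\<bar>x $ i\<bar> \<le> B / (w i * b $ i)" for i
      proof -
        have "w i * b $ i * \<bar>x $ i\<bar> \<le> (\<Sum>i\<in>UNIV. w i * b $ i * \<bar>x $ i\<bar>)"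
          using w b_pos by (intro member_le_sum) (auto simp: less_imp_le)
        also have "\<dots> \<le> B"
          using coercive[of x] that by (simp add: S_def B_def)
        finally show ?thesis
          using w[of i] b_pos[of i] by (simp add: field_simps)
      qed
      then show ?thesis
        using norm_le_l1_cart[of x] by (meson order_trans sum_mono)
    qed
    then show "bounded S"
      by (auto simp: bounded_iff)
  qed
  moreover have "S \<noteq> {}"
    by (auto simp: S_def)
  ultimately obtain x where x: "x \<in> S" "\<And>y. y \<in> S \<Longrightarrow> h x \<le> h y"
    using continuous_attains_inf[of S h] cont continuous_on_subset by blast
  have min: "h x \<le> h y" for y
  proof (cases "h y \<le> h 0")
    case False
    then show ?thesis
      using x(1) by (simp add: S_def)
  qed (use x(2) in \<open>simp add: S_def\<close>)
  have "weight x i = w i" for i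
  proof -
    \<comment> \<open>Changing price \<open>i\<close> changes only attraction \<open>i\<close>, so
      along this line \<open>h\<close> is \<open>G\<close> along an axis plus an affine
      function.\<close>
    have line: "h (x + s *\<^sub>R axis i 1) =
        G (Y x + (Y x $ i * (exp (- b $ i * s) - 1)) *\<^sub>R axis i 1) +
        ((\<Sum>i\<in>UNIV. w i * (b $ i * x $ i)) + w i * b $ i * s)" for s
    proof -
      have "Y (x + s *\<^sub>R axis i 1) = Y x + (Y x $ i * (exp (- b $ i * s) - 1)) *\<^sub>R axis i 1"
        by (simp add: vec_eq_iff Y_nth axis_def exp_diff exp_add exp_minus field_simps)
      moreover have "(\<Sum>j\<in>UNIV. w j * (b $ j * (x + s *\<^sub>R axis i 1) $ j)) =
          (\<Sum>i\<in>UNIV. w i * (b $ i * x $ i)) + w i * b $ i * s"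
        unfolding vector_add_component distrib_left sum.distrib
        by (simp add: axis_def if_distrib if_distribR mult_ac cong: if_cong)
      ultimately show ?thesis
        by (simp add: h_def)
    qed
    have "((\<lambda>s. G (Y x + s *\<^sub>R axis i 1)) has_real_derivative partial i G (Y x))
        (at (Y x $ i * (exp (- b $ i * 0) - 1)))"
      using has_real_derivative_partial[OF G.differentiable[OF Y_pos]] by simp
    moreover have "((\<lambda>s. Y x $ i * (exp (- b $ i * s) - 1)) has_real_derivative - b $ i * Y x $ i) (at 0)"
      by (auto intro!: derivative_eq_intros)
    ultimately have "((\<lambda>s. G (Y x + (Y x $ i * (exp (- b $ i * s) - 1)) *\<^sub>R axis i 1))
        has_real_derivative partial i G (Y x) * (- b $ i * Y x $ i)) (at 0)"
      by (rule DERIV_chain2)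
    moreover have "((\<lambda>s. (\<Sum>i\<in>UNIV. w i * (b $ i * x $ i)) + w i * b $ i * s)
        has_real_derivative w i * b $ i) (at 0)"
      by (auto intro!: derivative_eq_intros)
    ultimately have "((\<lambda>s. h (x + s *\<^sub>R axis i 1)) has_real_derivative
        partial i G (Y x) * (- b $ i * Y x $ i) + w i * b $ i) (at 0)"
      unfolding line by (rule DERIV_add)
    moreover have "\<forall>s. \<bar>0 - s\<bar> < 1 \<longrightarrow> h (x + 0 *\<^sub>R axis i 1) \<le> h (x + s *\<^sub>R axis i 1)"
      by (simp add: min)
    ultimately have "partial i G (Y x) * (- b $ i * Y x $ i) + w i * b $ i = 0"
      by (rule DERIV_local_min[OF _ zero_less_one])
    then have "b $ i * (w i - weight x i) = 0"
      by (simp add: weight_def algebra_simps)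
    then show ?thesis
      using b_pos[of i] by simp
  qed
  then show ?thesis
    by (rule that)
qed

text \<open>The no-purchase probability is \<open>1 / (1 + G (Y x))\<close>; requiring it to be
  \<open>q0\<close> forces the weights \<open>q $ i / q0\<close>.\<close>

lemma ex_p_eq:
  assumes q: "\<And>i. 0 < q $ i" and sum: "(\<Sum>i\<in>UNIV. q $ i) < 1"
  obtains x where "p x = q"
proof -
  define q0 where "q0 = 1 - (\<Sum>i\<in>UNIV. q $ i)"
  have q0: "0 < q0"
    using sum by (simp add: q0_def)
  obtain x where x: "\<And>i. weight x i = q $ i / q0"
    using ex_weight_eq[of "\<lambda>i. q $ i / q0"] q q0 by auto
  have "1 + G (Y x) = 1 / q0"
    using q0 by (simp add: G_eq x sum_divide_distrib[symmetric] q0_def field_simps)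
  then have "p x = q"
    using q0 by (simp add: vec_eq_iff p_nth x)
  then show ?thesis
    by (rule that)
qed

subsection \<open>Lowering the purchase probabilities\<close>

text \<open>Smaller probabilities have a smaller sum, hence a smaller \<open>G\<close>, hence
  smaller weights \<open>p * (1 + G)\<close>.\<close>

lemma W_Y_mono:
  assumes "\<And>i. p x $ i \<le> p z $ i"
  shows "W (Y x) \<le> W (Y z)"
proof -
  have "1 / (1 + G (Y z)) \<le> 1 / (1 + G (Y x))"
    using sum_mono[of UNIV "\<lambda>i. p x $ i" "\<lambda>i. p z $ i"] assms by (simp add: sum_p)
  then have G: "1 + G (Y x) \<le> 1 + G (Y z)"
    using G_pos[of x] G_pos[of z] by (simp add: field_simps)
  have "weight x i \<le> weight z i" for i
  proof -
    have "weight x i = p x $ i * (1 + G (Y x))" "weight z i = p z $ i * (1 + G (Y z))"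
      using G_pos[of x] G_pos[of z] by (simp_all add: p_nth)
    then show ?thesis
      using mult_mono[OF assms[of i] G] p_pos[of z i] G_pos[of x] by (simp add: less_imp_le)
  qed
  then show ?thesis
    unfolding W_eq using b_pos by (intro sum_mono divide_right_mono) (auto simp: less_imp_le)
qed

text \<open>The part of the difference not on the right is the sum of
  \<open>(z $ i - x $ i) * p z $ i\<close>. It is nonpositive by the tangent inequality at
  \<open>z\<close> together with \<open>W (Y x) \<le> W (Y z)\<close>.\<close>

lemma expected_revenue_diff_le:
  assumes "\<And>i. p x $ i \<le> p z $ i"
  shows "expected_revenue G a b c z - expected_revenue G a b c x \<le>
    (\<Sum>i\<in>UNIV. (x $ i - c $ i) * (p z $ i - p x $ i))"
proof -
  have "(\<Sum>i\<in>UNIV. (z $ i - x $ i) * p z $ i) = (\<Sum>i\<in>UNIV. weight z i * (z $ i - x $ i)) / (1 + G (Y z))"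
    by (simp add: p_nth sum_divide_distrib mult_ac)
  also have "\<dots> \<le> 0"
    using W_Y_tangent[of z x] W_Y_mono[OF assms] G_pos[of z] by (intro divide_nonpos_pos) auto
  finally have "(\<Sum>i\<in>UNIV. (z $ i - x $ i) * p z $ i) \<le> 0" .
  moreover have "expected_revenue G a b c z - expected_revenue G a b c x =
      (\<Sum>i\<in>UNIV. (x $ i - c $ i) * (p z $ i - p x $ i)) + (\<Sum>i\<in>UNIV. (z $ i - x $ i) * p z $ i)"
    by (simp add: expected_revenue_def sum.distrib[symmetric] sum_subtractf[symmetric] algebra_simps)
  ultimately show ?thesis
    by simp
qed

text \<open>To apply the bound, replace negative prices by zero, which only raises \<open>\<partial>\<^sub>i G\<close>.\<close>

lemma price_le:
  assumes bound: "\<And>x i. (\<And>i. 0 \<le> x $ i) \<Longrightarrow> weight x i \<le> L i * Y x $ i powr l i"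
    and L: "0 < L i" and l: "0 < l i" and \<delta>: "0 < \<delta>" "\<delta> \<le> p x $ i"
  shows "x $ i \<le> max (a $ i / b $ i - 1 / (b $ i * l i) * ln (\<delta> / L i)) 0"
proof (cases "0 \<le> x $ i")
  case True
  define z :: "real^'v" where "z = (\<chi> j. max 0 (x $ j))"
  have Yi: "Y z $ i = Y x $ i"
    using True by (simp add: z_def Y_nth)
  have "partial i G (Y x) \<le> partial i G (Y z)"
    using b_pos by (intro G.partial_antimono Y_pos Yi) (simp add: z_def Y_nth mult_left_mono)
  then have "weight x i \<le> weight z i"
    by (simp add: weight_def Yi) (simp add: Y_nth)
  also have "\<dots> \<le> L i * Y z $ i powr l i"
    by (rule bound) (simp add: z_def)
  finally have "\<delta> \<le> L i * Y x $ i powr l i"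
    using \<delta>(2) p_le_weight[of x i] Yi by simp
  then have "\<delta> / L i \<le> exp (l i * (a $ i - b $ i * x $ i))"
    using L by (simp add: Y_nth powr_def field_simps)
  then have "ln (\<delta> / L i) \<le> l i * (a $ i - b $ i * x $ i)"
    using \<delta>(1) L by (metis divide_pos_pos exp_le_cancel_iff exp_ln)
  then have "x $ i \<le> a $ i / b $ i - 1 / (b $ i * l i) * ln (\<delta> / L i)"
    using b_pos[of i] l by (simp add: field_simps)
  then show ?thesis
    by simp
qed simp

subsection \<open>Stability of the unconstrained optimum\<close>

text \<open>\<open>shortfall\<close> is the Bregman divergence of \<open>x \<mapsto> W (Y x)\<close> from \<open>best_prices\<close>.\<close>

definition best_prices :: "real^'v" where
  "best_prices = (\<chi> i. c $ i + unconstrained_value G a b c + 1 / b $ i)"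

definition shortfall :: "real^'v \<Rightarrow> real" where
  "shortfall x = W (Y best_prices) - W (Y x) - (\<Sum>i\<in>UNIV. weight x i * (x $ i - best_prices $ i))"

text \<open>Clearing the denominator \<open>1 + G\<close>, as in fractional programming. The
  summands of \<open>best_prices\<close> are chosen so that the price terms collect into
  \<open>\<Delta>\<^sup>* * G\<close> and \<open>W\<close>.\<close>

lemma expected_revenue_eq_shortfall:
  "(expected_revenue G a b c x - unconstrained_value G a b c) * (1 + G (Y x)) =
    W (Y best_prices) - shortfall x - unconstrained_value G a b c"
proof -
  let ?\<Delta> = "unconstrained_value G a b c"
  have "expected_revenue G a b c x * (1 + G (Y x)) = (\<Sum>i\<in>UNIV. (x $ i - c $ i) * weight x i)"
    using G_pos[of x] by (simp add: expected_revenue_def p_nth sum_divide_distrib[symmetric])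
  moreover have "(\<Sum>i\<in>UNIV. weight x i * (x $ i - best_prices $ i)) =
      (\<Sum>i\<in>UNIV. (x $ i - c $ i) * weight x i) - ?\<Delta> * G (Y x) - W (Y x)"
    by (simp add: best_prices_def G_eq W_eq sum_distrib_left sum_subtractf[symmetric] algebra_simps)
  ultimately show ?thesis
    by (simp add: shortfall_def algebra_simps)
qed

text \<open>At \<open>best_prices\<close> the divergence is zero and the revenue at most
  \<open>\<Delta>\<^sup>*\<close>, so the identity above yields
  \<open>W (Y best_prices) \<le> \<Delta>\<^sup>*\<close>.\<close>

lemma shortfall_le:
  "shortfall x \<le> (unconstrained_value G a b c - expected_revenue G a b c x) * (1 + G (Y x))"
proof -
  have "shortfall best_prices = 0"
    by (simp add: shortfall_def)
  moreover have "(expected_revenue G a b c best_prices - unconstrained_value G a b c) *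
      (1 + G (Y best_prices)) \<le> 0"
    using expected_revenue_le_unconstrained[of best_prices] G_pos[of best_prices]
    by (intro mult_nonpos_nonneg) auto
  ultimately have "W (Y best_prices) \<le> unconstrained_value G a b c"
    using expected_revenue_eq_shortfall[of best_prices] by simp
  then show ?thesis
    using expected_revenue_eq_shortfall[of x] by (simp add: algebra_simps)
qed

text \<open>\<open>W\<close> is only known to be convex; strictness comes from \<open>exp\<close> in
  a coordinate \<open>j\<close> where the prices differ.\<close>

lemma shortfall_pos:
  assumes "x \<noteq> best_prices"
  shows "0 < shortfall x"
proof -
  define t where "t i = b $ i * (x $ i - best_prices $ i)" for i
  obtain j where j: "x $ j \<noteq> best_prices $ j"
    using assms by (auto simp: vec_eq_iff)
  have W_partial: "Y best_prices $ i * partial i W (Y x) = weight x i / b $ i * exp (t i)" for i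
    by (simp add: partial_W[OF Y_pos] weight_def t_def Y_change[of best_prices i x])
  have "0 < (\<Sum>i\<in>UNIV. weight x i / b $ i * (exp (t i) - (1 + t i)))"
  proof (rule sum_pos2[of _ j])
    have "t j \<noteq> 0"
      using j b_pos[of j] by (simp add: t_def)
    then show "0 < weight x j / b $ j * (exp (t j) - (1 + t j))"
      using exp_gt_tangent weight_pos[of x j] b_pos[of j] by simp
    show "0 \<le> weight x i / b $ i * (exp (t i) - (1 + t i))" for i
      using exp_ge_add_one_self[of "t i"] weight_pos[of x i] b_pos[of i]
      by (intro mult_nonneg_nonneg) (auto simp: less_imp_le)
  qed auto
  also have "\<dots> = (\<Sum>i\<in>UNIV. Y best_prices $ i * partial i W (Y x)) -
      (\<Sum>i\<in>UNIV. weight x i / b $ i * (1 + t i))"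
    by (simp only: right_diff_distrib sum_subtractf W_partial)
  also have "(\<Sum>i\<in>UNIV. weight x i / b $ i * (1 + t i)) =
      W (Y x) + (\<Sum>i\<in>UNIV. weight x i * (x $ i - best_prices $ i))"
    using b_pos by (simp add: W_eq t_def distrib_left sum.distrib less_imp_neq[THEN not_sym])
  also have "(\<Sum>i\<in>UNIV. Y best_prices $ i * partial i W (Y x)) \<le> W (Y best_prices)"
    by (rule W.tangent_le[OF Y_pos Y_pos])
  finally show ?thesis
    by (simp add: shortfall_def)
qed

text \<open>For very attractive prices \<open>1 + G\<close> is large, and a constant lower bound on
  the divergence would not survive division by it; linear growth in \<open>G\<close> does.\<close>

lemma shortfall_ge_linear:
  obtains \<beta> K where "0 < \<beta>" "0 \<le> K" "\<And>x. \<beta> * G (Y x) - K \<le> shortfall x"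
proof
  define \<beta> where "\<beta> = Min (range (\<lambda>i. 1 / b $ i))"
  define K where "K = (\<Sum>i\<in>UNIV. G 1 * Y best_prices $ i * exp 1 / b $ i)"
  show "0 < \<beta>"
    using b_pos by (simp add: \<beta>_def)
  show "0 \<le> K"
    unfolding K_def using G_1_pos b_pos by (intro sum_nonneg) (simp add: Y_nth less_imp_le)
  fix x
  define t where "t i = b $ i * (x $ i - best_prices $ i)" for i
  \<comment> \<open>The tangent of \<open>exp\<close> shifted by one produces \<open>2 + t i\<close>
    instead of \<open>1 + t i\<close>, leaving a whole \<open>W (Y x)\<close> in surplus.\<close>
  have "(\<Sum>i\<in>UNIV. weight x i / b $ i * (2 + t i)) \<le> K"
    unfolding K_def
  proof (intro sum_mono)
    fix i
    have "weight x i * (2 + t i) \<le> weight x i * exp (1 + t i)"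
      using exp_ge_add_one_self[of "1 + t i"] weight_pos[of x i] by (intro mult_left_mono) auto
    also have "\<dots> \<le> G 1 * Y x $ i * exp (1 + t i)"
      by (intro mult_right_mono weight_le) simp
    also have "\<dots> = G 1 * Y best_prices $ i * exp 1"
      by (simp add: Y_change[of best_prices i x] t_def exp_add mult_ac)
    finally show "weight x i / b $ i * (2 + t i) \<le> G 1 * Y best_prices $ i * exp 1 / b $ i"
      using b_pos[of i] by (simp add: divide_right_mono)
  qed
  moreover have "(\<Sum>i\<in>UNIV. weight x i / b $ i * (2 + t i)) =
      2 * W (Y x) + (\<Sum>i\<in>UNIV. weight x i * (x $ i - best_prices $ i))"
    using b_pos
    by (simp add: W_eq t_def distrib_left sum.distrib sum_distrib_left less_imp_neq[THEN not_sym] mult_ac)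
  moreover have "0 \<le> W (Y best_prices)"
    unfolding W_eq using weight_pos b_pos by (intro sum_nonneg divide_nonneg_pos) (auto simp: less_imp_le)
  moreover have "\<beta> * G (Y x) \<le> W (Y x)"
    unfolding G_eq W_eq sum_distrib_left
  proof (intro sum_mono)
    fix i
    have "\<beta> \<le> 1 / b $ i"
      by (simp add: \<beta>_def)
    then show "\<beta> * weight x i \<le> weight x i / b $ i"
      using mult_right_mono[of \<beta> "1 / b $ i" "weight x i"] weight_pos[of x i] by simp
  qed
  ultimately show "\<beta> * G (Y x) - K \<le> shortfall x"
    by (simp add: shortfall_def)
qed

text \<open>Monotonicity of the gradient of a convex function along the ray.\<close>

lemma shortfall_mono_on_ray:
  assumes "1 \<le> s"
  shows "shortfall (best_prices + d) \<le> shortfall (best_prices + s *\<^sub>R d)"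
proof (cases "s = 1")
  case False
  define y where "y = best_prices + d"
  define x where "x = best_prices + s *\<^sub>R d"
  define wy where "wy = (\<Sum>i\<in>UNIV. weight y i * d $ i)"
  define wx where "wx = (\<Sum>i\<in>UNIV. weight x i * d $ i)"
  have "(\<Sum>i\<in>UNIV. weight x i * (x $ i - y $ i)) = (s - 1) * wx"
    by (simp add: x_def y_def wx_def sum_distrib_left algebra_simps)
  then have x: "W (Y x) + (s - 1) * wx \<le> W (Y y)"
    using W_Y_tangent[of x y] by simp
  have "(\<Sum>i\<in>UNIV. weight y i * (y $ i - x $ i)) = (1 - s) * wy"
    by (simp add: x_def y_def wy_def sum_distrib_left algebra_simps)
  then have y: "W (Y y) + (1 - s) * wy \<le> W (Y x)"
    using W_Y_tangent[of y x] by simp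
  have "(s - 1) * (wx - wy) \<le> 0"
    using x y by (simp add: algebra_simps)
  then have "wx \<le> wy"
    using assms False by (simp add: mult_le_0_iff)
  moreover have "shortfall x = W (Y best_prices) - W (Y x) - s * wx"
    by (simp add: shortfall_def x_def wx_def sum_distrib_left mult_ac)
  moreover have "shortfall y = W (Y best_prices) - W (Y y) - wy"
    by (simp add: shortfall_def y_def wy_def)
  ultimately show ?thesis
    using x unfolding x_def y_def by (simp add: algebra_simps)
qed simp

text \<open>The positive continuous divergence has a positive minimum on a sphere; growth along rays
  carries it to all points outside.\<close>

lemma shortfall_away_from_best_prices:
  assumes \<rho>: "0 < \<rho>"
  obtains \<eta> where "0 < \<eta>" "\<And>x. \<rho> \<le> dist x best_prices \<Longrightarrow> \<eta> \<le> shortfall x"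
proof -
  have "continuous_on (sphere best_prices \<rho>) shortfall"
    unfolding shortfall_def
    by (intro continuous_intros continuous_on_subset[OF continuous_on_W_Y]
        continuous_on_subset[OF continuous_on_weight]) auto
  moreover have "sphere best_prices \<rho> \<noteq> {}"
    using \<rho> by simp
  ultimately obtain z where z: "z \<in> sphere best_prices \<rho>"
      "\<And>y. y \<in> sphere best_prices \<rho> \<Longrightarrow> shortfall z \<le> shortfall y"
    using continuous_attains_inf[OF compact_sphere] by metis
  show ?thesis
  proof
    show "0 < shortfall z"
      using z(1) \<rho> by (intro shortfall_pos) auto
    fix x assume x: "\<rho> \<le> dist x best_prices"
    then have x_ne: "x \<noteq> best_prices"
      using \<rho> by (metis dist_self not_le)
    define d where "d = (\<rho> / dist x best_prices) *\<^sub>R (x - best_prices)"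
    have "shortfall z \<le> shortfall (best_prices + d)"
      using \<rho> x_ne by (intro z(2)) (simp add: d_def dist_norm)
    also have "\<dots> \<le> shortfall (best_prices + (dist x best_prices / \<rho>) *\<^sub>R d)"
      using \<rho> x by (intro shortfall_mono_on_ray) simp
    also have "best_prices + (dist x best_prices / \<rho>) *\<^sub>R d = x"
      using \<rho> x_ne by (simp add: d_def)
    finally show "shortfall z \<le> shortfall x" .
  qed
qed

lemma expected_revenue_away_from_best_prices:
  assumes \<rho>: "0 < \<rho>"
  obtains \<eta> where "0 < \<eta>"
    "\<And>x. \<rho> \<le> dist x best_prices \<Longrightarrow>
      expected_revenue G a b c x \<le> unconstrained_value G a b c - \<eta>"
proof -
  obtain \<beta> K where \<beta>: "0 < \<beta>" and K: "0 \<le> K"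
    and linear: "\<And>x. \<beta> * G (Y x) - K \<le> shortfall x"
    by (rule shortfall_ge_linear) blast
  obtain \<eta> where \<eta>: "0 < \<eta>" and away: "\<And>x. \<rho> \<le> dist x best_prices \<Longrightarrow> \<eta> \<le> shortfall x"
    using shortfall_away_from_best_prices[OF \<rho>] by blast
  \<comment> \<open>From \<open>M\<close> on, half of \<open>\<beta> * G\<close> absorbs
    \<open>K\<close> and \<open>1 + G \<le> 2 * G\<close>, which leaves the gap
    \<open>\<beta> / 4\<close>. Below \<open>M\<close> the factor \<open>1 + G\<close> is bounded
    and \<open>\<eta>\<close> suffices.\<close>
  define M where "M = max 1 (2 * K / \<beta>)"
  show ?thesis
  proof
    show "0 < min (\<beta> / 4) (\<eta> / (1 + M))"
      using \<beta> \<eta> by (simp add: M_def add_pos_pos less_max_iff_disj)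
    fix x assume x: "\<rho> \<le> dist x best_prices"
    have G: "0 < G (Y x)"
      by (rule G_pos)
    have "min (\<beta> / 4) (\<eta> / (1 + M)) * (1 + G (Y x)) \<le> shortfall x"
    proof (cases "M \<le> G (Y x)")
      case True
      then have "1 \<le> G (Y x)" "2 * K \<le> \<beta> * G (Y x)"
        using \<beta> by (simp_all add: M_def field_simps)
      have "min (\<beta> / 4) (\<eta> / (1 + M)) * (1 + G (Y x)) \<le> \<beta> / 4 * (2 * G (Y x))"
        using \<open>1 \<le> G (Y x)\<close> \<beta> by (intro mult_mono min.cobounded1) auto
      also have "\<dots> \<le> \<beta> * G (Y x) - K"
        using \<open>2 * K \<le> \<beta> * G (Y x)\<close> by simp
      finally show ?thesis
        using linear[of x] by linarith
    next
      case False
      then have "min (\<beta> / 4) (\<eta> / (1 + M)) * (1 + G (Y x)) \<le> \<eta> / (1 + M) * (1 + M)"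
        using G \<eta> by (intro mult_mono) auto
      also have "\<dots> = \<eta>"
        using False G by simp
      finally show ?thesis
        using away[OF x] by linarith
    qed
    also have "\<dots> \<le> (unconstrained_value G a b c - expected_revenue G a b c x) * (1 + G (Y x))"
      by (rule shortfall_le)
    finally show "expected_revenue G a b c x \<le>
        unconstrained_value G a b c - min (\<beta> / 4) (\<eta> / (1 + M))"
      using G by simp
  qed
qed

lemma best_prices_if_optimal:
  assumes "expected_revenue G a b c x = unconstrained_value G a b c"
  shows "x = best_prices"
  using shortfall_le[of x] shortfall_pos[of x] assms by fastforce

subsection \<open>Expected sale constraints\<close>

context
  fixes \<alpha> :: "'t::finite \<Rightarrow> real^'v" and r :: "'t \<Rightarrow> real"
begin

lemma penalized_revenue_le_revenue:
  assumes "\<And>t. 0 \<le> lam $ t"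
  shows "penalized_revenue G a b c \<alpha> r lam q \<le> revenue G a b c q"
  using assms by (simp add: penalized_revenue_def violation_def sum_nonneg)

lemma penalized_revenue_feasible:
  "q \<in> constrained_probs G a b \<alpha> r \<Longrightarrow> penalized_revenue G a b c \<alpha> r lam q = revenue G a b c q"
  by (simp add: penalized_revenue_def violation_def constrained_probs_def max_absorb1)

lemma constrained_value_le_penalized_value:
  assumes "constrained_probs G a b \<alpha> r \<noteq> {}" and lam: "\<And>t. 0 \<le> lam $ t"
  shows "constrained_value G a b c \<alpha> r \<le> penalized_value G a b c \<alpha> r lam"
  unfolding constrained_value_def penalized_value_def
proof (rule cSUP_mono[OF assms(1)])
  show "bdd_above (penalized_revenue G a b c \<alpha> r lam ` sale_probs G a b)"
    using order_trans[OF penalized_revenue_le_revenue[OF lam] revenue_le_unconstrained]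
    by (rule bdd_aboveI2)
  show "\<exists>q'\<in>sale_probs G a b. revenue G a b c q \<le> penalized_revenue G a b c \<alpha> r lam q'"
    if "q \<in> constrained_probs G a b \<alpha> r" for q
    using that penalized_revenue_feasible[OF that, of lam]
    by (intro bexI[of _ q]) (auto simp: constrained_probs_def)
qed

lemma revenue_le_constrained_value:
  assumes "q \<in> constrained_probs G a b \<alpha> r"
  shows "revenue G a b c q \<le> constrained_value G a b c \<alpha> r"
  unfolding constrained_value_def
proof (rule cSUP_upper[OF assms])
  show "bdd_above (revenue G a b c ` constrained_probs G a b \<alpha> r)"
    by (rule bdd_aboveI2[OF revenue_le_unconstrained]) (simp add: constrained_probs_def)
qed

lemma penalized_value_eq:
  assumes "penalized_optimal G a b c \<alpha> r lam q"
  shows "penalized_value G a b c \<alpha> r lam = penalized_revenue G a b c \<alpha> r lam q"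
  unfolding penalized_value_def
  by (rule cSup_eq_maximum)
     (use assms in \<open>auto simp: penalized_optimal_def is_arg_max_def not_less\<close>)

text \<open>A constraint violated at \<open>best_prices\<close> is violated on a ball around it, so
  all feasible prices lie outside. As the constrained value is a supremum, a uniform revenue gap
  \<open>\<eta>\<close> there is needed for the contradiction.\<close>

lemma feasible_if_constraints_not_binding:
  assumes ne: "constrained_probs G a b \<alpha> r \<noteq> {}"
    and le: "unconstrained_value G a b c \<le> constrained_value G a b c \<alpha> r"
  shows "\<alpha> t \<bullet> p best_prices \<le> r t"
proof (rule ccontr)
  assume "\<not> ?thesis"
  then have pos: "best_prices \<in> {x. r t < \<alpha> t \<bullet> p x}"
    by simp
  moreover have "open {x. r t < \<alpha> t \<bullet> p x}"
    by (intro open_Collect_less continuous_intros continuous_on_p)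
  ultimately obtain \<rho> where \<rho>: "0 < \<rho>" "\<And>x. dist x best_prices < \<rho> \<Longrightarrow> r t < \<alpha> t \<bullet> p x"
    unfolding open_dist by blast
  obtain \<eta> where \<eta>: "0 < \<eta>" and away: "\<And>x. \<rho> \<le> dist x best_prices \<Longrightarrow>
      expected_revenue G a b c x \<le> unconstrained_value G a b c - \<eta>"
    using expected_revenue_away_from_best_prices[OF \<rho>(1)] by blast
  have "constrained_value G a b c \<alpha> r \<le> unconstrained_value G a b c - \<eta>"
    unfolding constrained_value_def
  proof (rule cSUP_least[OF ne])
    fix q assume q: "q \<in> constrained_probs G a b \<alpha> r"
    then have sale: "q \<in> sale_probs G a b" and "\<alpha> t \<bullet> q \<le> r t"
      by (auto simp: constrained_probs_def)
    then have "\<rho> \<le> dist (prices G a b q) best_prices"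
      using \<rho>(2)[of "prices G a b q"] p_prices[OF sale] by force
    then show "revenue G a b c q \<le> unconstrained_value G a b c - \<eta>"
      using away by (simp add: revenue_eq_expected_revenue[OF sale])
  qed
  with le \<eta> show False
    by simp
qed

text \<open>If the smallest penalty is zero, then the hypothesis on it says that the constraints do not
  lower the optimal value; in this case the unconstrained optimum itself must be feasible.\<close>

lemma total_violation_le:
  assumes ne: "constrained_probs G a b \<alpha> r \<noteq> {}" and lam: "\<And>t. 0 \<le> lam $ t" and \<epsilon>: "0 < \<epsilon>"
    and opt: "penalized_optimal G a b c \<alpha> r lam q"
    and large: "(unconstrained_value G a b c - constrained_value G a b c \<alpha> r) / \<epsilon> \<le>
      Min (range (\<lambda>t. lam $ t))"
  shows "total_violation \<alpha> r q \<le> \<epsilon>"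
proof -
  define l0 where "l0 = Min (range (\<lambda>t. lam $ t))"
  have l0: "0 \<le> l0" "l0 \<le> lam $ t" for t
    using lam by (simp_all add: l0_def)
  have sale: "q \<in> sale_probs G a b"
    using opt by (simp add: penalized_optimal_def is_arg_max_def)
  have attained: "constrained_value G a b c \<alpha> r \<le> penalized_revenue G a b c \<alpha> r lam q"
    using constrained_value_le_penalized_value[OF ne lam] penalized_value_eq[OF opt] by simp
  have gap: "unconstrained_value G a b c - constrained_value G a b c \<alpha> r \<le> l0 * \<epsilon>"
    using large \<epsilon> unfolding l0_def by (simp only: pos_divide_le_eq)
  show ?thesis
  proof (cases "l0 = 0")
    case True
    then have le: "unconstrained_value G a b c \<le> constrained_value G a b c \<alpha> r"
      using gap by simp
    \<comment> \<open>All inequalities in \<open>\<Delta>\<^sup>* \<le> v\<^sup>* \<le>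
      v\<^sup>\<lambda> \<le> R(q) \<le> \<Delta>\<^sup>*\<close> are equalities.\<close>
    then have "expected_revenue G a b c (prices G a b q) = unconstrained_value G a b c"
      using attained penalized_revenue_le_revenue[OF lam, of q] revenue_le_unconstrained[OF sale]
      by (simp add: revenue_eq_expected_revenue[OF sale])
    then have "q = p best_prices"
      using best_prices_if_optimal p_prices[OF sale] by metis
    then have "total_violation \<alpha> r q = 0"
      using feasible_if_constraints_not_binding[OF ne le]
      by (simp add: total_violation_def violation_def max_absorb1)
    then show ?thesis
      using \<epsilon> by simp
  next
    case False
    \<comment> \<open>The penalty paid at \<open>q\<close> is its revenue minus the penalized value,
      hence at most \<open>\<Delta>\<^sup>* - v\<^sup>*\<close>.\<close>
    have "l0 * total_violation \<alpha> r q \<le> (\<Sum>t\<in>UNIV. lam $ t * violation \<alpha> r q t)"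
      unfolding total_violation_def sum_distrib_left
      by (intro sum_mono mult_right_mono l0) (simp add: violation_def)
    also have "\<dots> \<le> l0 * \<epsilon>"
      using attained revenue_le_unconstrained[OF sale] gap by (simp add: penalized_revenue_def)
    finally show ?thesis
      using False l0(1) by simp
  qed
qed

end

end

section \<open>Comparing the constrained and the penalized problem\<close>

lemma inner_vec_eq_sum: "x \<bullet> y = (\<Sum>i\<in>UNIV. x $ i * y $ i)" for x y :: "real^'v::finite"
  by (simp add: inner_vec_def)

lemma min_pos_coeff:
  fixes \<alpha> :: "'t::finite \<Rightarrow> real^'v::finite"
  assumes "0 < \<alpha> t $ i"
  shows "0 < min_pos_coeff \<alpha>" and "min_pos_coeff \<alpha> \<le> \<alpha> t $ i"
proof -
  let ?A = "{\<alpha> t $ i | t i. 0 < \<alpha> t $ i}"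
  have "finite ?A"
    by (rule finite_subset[of _ "range (\<lambda>(t, i). \<alpha> t $ i)"]) auto
  moreover have "\<alpha> t $ i \<in> ?A"
    using assms by blast
  ultimately have "Min ?A \<in> ?A" and "Min ?A \<le> \<alpha> t $ i"
    using Min_in[of ?A] Min_le[of ?A "\<alpha> t $ i"] by blast+
  then show "0 < min_pos_coeff \<alpha>" and "min_pos_coeff \<alpha> \<le> \<alpha> t $ i"
    unfolding min_pos_coeff_def by auto
qed

text \<open>The truncation lowers the probabilities above \<open>\<delta>\<close>, each by at most \<open>\<kappa>\<close>.  If a constraint
  involves some \<open>q\<^sub>j \<ge> \<rho>\<close>, lowering \<open>q\<^sub>j\<close> by \<open>\<kappa>\<close> alone makes up for the violation; otherwise it
  only involves probabilities that are at most \<open>\<rho>\<close>.\<close>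

definition truncate :: "real \<Rightarrow> real \<Rightarrow> real^'v \<Rightarrow> real^'v::finite" where
  "truncate \<delta> \<kappa> q = (\<chi> i. min (q $ i) (max \<delta> (q $ i - \<kappa>)))"

lemma truncate_feasible:
  fixes \<alpha> :: "'t::finite \<Rightarrow> real^'v::finite"
  assumes \<alpha>: "\<And>i. 0 \<le> \<alpha> t $ i" and \<kappa>: "0 \<le> \<kappa>" "\<And>i. 0 < \<alpha> t $ i \<Longrightarrow> \<epsilon> \<le> \<alpha> t $ i * \<kappa>"
    and \<rho>: "\<rho> * (\<alpha> t \<bullet> 1) \<le> r t" and viol: "\<alpha> t \<bullet> q - r t \<le> \<epsilon>"
  shows "\<alpha> t \<bullet> truncate (\<rho> - \<kappa>) \<kappa> q \<le> r t"
proof (cases "\<exists>j. 0 < \<alpha> t $ j \<and> \<rho> \<le> q $ j")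
  case True
  then obtain j where j: "0 < \<alpha> t $ j" "\<rho> \<le> q $ j"
    by blast
  let ?d = "\<lambda>i. \<alpha> t $ i * (q $ i - truncate (\<rho> - \<kappa>) \<kappa> q $ i)"
  \<comment> \<open>Since \<open>q $ j - \<kappa>\<close> is at least the cutoff
    \<open>\<rho> - \<kappa>\<close>, the truncation lowers \<open>q $ j\<close> by exactly
    \<open>\<kappa>\<close>.\<close>
  have "\<epsilon> \<le> ?d j"
    using \<kappa> j by (simp add: truncate_def)
  also have "\<dots> \<le> (\<Sum>i\<in>UNIV. ?d i)"
    using \<alpha> by (intro member_le_sum) (auto simp: truncate_def)
  also have "\<dots> = \<alpha> t \<bullet> q - \<alpha> t \<bullet> truncate (\<rho> - \<kappa>) \<kappa> q"
    by (simp add: inner_vec_eq_sum right_diff_distrib sum_subtractf)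
  finally show ?thesis
    using viol by linarith
next
  case False
  have "\<alpha> t \<bullet> truncate (\<rho> - \<kappa>) \<kappa> q \<le> (\<Sum>i\<in>UNIV. \<alpha> t $ i * \<rho>)"
    unfolding inner_vec_eq_sum
  proof (intro sum_mono)
    fix i
    show "\<alpha> t $ i * truncate (\<rho> - \<kappa>) \<kappa> q $ i \<le> \<alpha> t $ i * \<rho>"
    proof (cases "\<alpha> t $ i = 0")
      case nz: False
      then have "q $ i < \<rho>"
        using False \<alpha>[of i] by (metis not_le order_le_less)
      then show ?thesis
        using \<alpha>[of i] by (intro mult_left_mono) (auto simp: truncate_def)
    qed simp
  qed
  also have "\<dots> = \<rho> * (\<alpha> t \<bullet> 1)"
    by (simp add: inner_vec_eq_sum sum_distrib_left mult.commute)
  finally show ?thesis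
    using \<rho> by linarith
qed

text \<open>Excludes degenerate quotients: if all coefficients were zero, every ratio would be
  \<open>r t / 0 = 0\<close>, against \<open>0 < \<epsilon>\<close>. Likewise a positive minimal
  ratio forces every denominator to be nonzero.\<close>

lemma positive_ratio_facts:
  fixes \<alpha> :: "'t::finite \<Rightarrow> real^'v::finite"
  assumes \<alpha>: "\<And>t i. 0 \<le> \<alpha> t $ i" and "0 < \<epsilon>" "\<epsilon> \<le> min_pos_coeff \<alpha> * min_ratio \<alpha> r"
  shows "0 < min_pos_coeff \<alpha>" and "0 < min_ratio \<alpha> r" and "min_ratio \<alpha> r * (\<alpha> t \<bullet> 1) \<le> r t"
proof -
  have ratio: "min_ratio \<alpha> r \<le> r t / (\<alpha> t \<bullet> 1)" for t
    by (simp add: min_ratio_def)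
  have "\<exists>t i. 0 < \<alpha> t $ i"
  proof (rule ccontr)
    assume "\<not> ?thesis"
    then have "\<alpha> t \<bullet> 1 = 0" for t
      using \<alpha> by (simp add: inner_vec_eq_sum) (metis antisym_conv2 sum.neutral)
    then have "min_ratio \<alpha> r = 0"
      by (simp add: min_ratio_def)
    then show False
      using assms(2,3) by simp
  qed
  then show \<mu>: "0 < min_pos_coeff \<alpha>"
    using min_pos_coeff(1) by blast
  then show pos: "0 < min_ratio \<alpha> r"
    using assms(2,3) by (meson less_le_trans zero_less_mult_pos)
  have "0 \<le> \<alpha> t \<bullet> 1"
    using \<alpha> by (simp add: inner_vec_eq_sum sum_nonneg)
  moreover have "\<alpha> t \<bullet> 1 \<noteq> 0"
    using ratio[of t] pos by auto
  ultimately show "min_ratio \<alpha> r * (\<alpha> t \<bullet> 1) \<le> r t"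
    using ratio[of t] by (simp add: pos_le_divide_eq)
qed

text \<open>The gap is at most the revenue lost by truncating \<open>q\<close> to a feasible
  \<open>q'\<close>. A lowered coordinate stays at least \<open>\<delta>\<close>, so
  \<open>price_le\<close> bounds its price.\<close>

lemma (in gev_pricing) value_gap_le:
  fixes \<alpha> :: "'t::finite \<Rightarrow> real^'v"
  assumes bound: "\<And>x i. (\<And>i. 0 \<le> x $ i) \<Longrightarrow> weight x i \<le> L i * Y x $ i powr l i"
    and L: "\<And>i. 0 < L i" and l: "\<And>i. 0 < l i"
    and c: "\<And>i. 0 \<le> c $ i" and \<alpha>: "\<And>t i. 0 \<le> \<alpha> t $ i"
    and \<epsilon>: "0 < \<epsilon>" "\<epsilon> \<le> min_pos_coeff \<alpha> * min_ratio \<alpha> r"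
    and lam: "\<And>t. 0 \<le> lam $ t" and opt: "penalized_optimal G a b c \<alpha> r lam q"
    and large: "(unconstrained_value G a b c - constrained_value G a b c \<alpha> r) / \<epsilon> \<le>
      Min (range (\<lambda>t. lam $ t))"
  shows "ereal \<bar>penalized_value G a b c \<alpha> r lam - constrained_value G a b c \<alpha> r\<bar> \<le>
    gap_bound a b L l \<alpha> r \<epsilon>"
proof (cases "slack \<alpha> r \<epsilon> \<le> 0")
  case False
  define \<rho> where "\<rho> = min_ratio \<alpha> r"
  define \<kappa> where "\<kappa> = \<epsilon> / min_pos_coeff \<alpha>"
  define \<delta> where "\<delta> = slack \<alpha> r \<epsilon>"
  have \<delta>: "0 < \<delta>" "\<delta> = \<rho> - \<kappa>"
    using False by (simp_all add: \<delta>_def slack_def \<rho>_def \<kappa>_def)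
  note facts = positive_ratio_facts[OF \<alpha> \<epsilon>]
  have \<kappa>: "0 < \<kappa>"
    using facts(1) \<epsilon>(1) by (simp add: \<kappa>_def)
  have ne: "constrained_probs G a b \<alpha> r \<noteq> {}"
  proof -
    \<comment> \<open>Entries at most \<open>\<rho>\<close> satisfy every constraint, and entries at
      most \<open>1 / (1 + m)\<close> have a sum below 1.\<close>
    define q :: "real^'v" where "q = (\<chi> i. min \<rho> (1 / (1 + real CARD('v))))"
    have "(\<Sum>i\<in>UNIV. q $ i) \<le> real CARD('v) * (1 / (1 + real CARD('v)))"
      by (simp add: q_def mult_left_mono del: times_divide_eq_right)
    also have "\<dots> < 1"
      by (simp add: field_simps)
    finally have "(\<Sum>i\<in>UNIV. q $ i) < 1" .
    moreover have "0 < q $ i" for i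
      using facts(2) by (simp add: q_def \<rho>_def)
    ultimately obtain x where x: "p x = q"
      using ex_p_eq by blast
    have "\<alpha> t \<bullet> q \<le> r t" for t
    proof -
      have "\<alpha> t \<bullet> q \<le> (\<Sum>i\<in>UNIV. \<alpha> t $ i * \<rho>)"
        unfolding inner_vec_eq_sum by (intro sum_mono mult_left_mono \<alpha>) (simp add: q_def)
      also have "\<dots> = \<rho> * (\<alpha> t \<bullet> 1)"
        by (simp add: inner_vec_eq_sum sum_distrib_left mult.commute)
      finally show ?thesis
        using facts(3)[of t] by (simp add: \<rho>_def)
    qed
    then have "q \<in> constrained_probs G a b \<alpha> r"
      using p_in_sale_probs[of x] by (simp add: x constrained_probs_def)
    then show ?thesis
      by blast
  qed
  define B where "B = max (Max (range (\<lambda>i. a $ i / b $ i - 1 / (b $ i * l i) * ln (\<delta> / L i)))) 0"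
  define q' where "q' = truncate \<delta> \<kappa> q"
  have sale: "q \<in> sale_probs G a b"
    using opt by (simp add: penalized_optimal_def is_arg_max_def)
  then obtain z where z: "p z = q"
    by (auto simp: sale_probs_def)
  have q'_le: "q' $ i \<le> q $ i" for i
    by (simp add: q'_def truncate_def)
  have q'_pos: "0 < q' $ i" for i
    using p_pos[of z i] \<delta>(1) by (simp add: q'_def truncate_def z less_max_iff_disj)
  have "(\<Sum>i\<in>UNIV. q' $ i) \<le> (\<Sum>i\<in>UNIV. q $ i)"
    by (intro sum_mono q'_le)
  then have "(\<Sum>i\<in>UNIV. q' $ i) < 1"
    using sum_p_less_1[of z] by (simp add: z)
  then obtain x where "p x = q'"
    using ex_p_eq[OF q'_pos] by blast
  then have sale': "q' \<in> sale_probs G a b"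
    using p_in_sale_probs[of x] by simp
  have "\<alpha> t \<bullet> q' \<le> r t" for t
    unfolding q'_def \<delta>(2)
  proof (rule truncate_feasible[OF \<alpha>, where \<epsilon> = \<epsilon>])
    show "0 \<le> \<kappa>"
      using \<kappa> by simp
    show "\<epsilon> \<le> \<alpha> t $ i * \<kappa>" if "0 < \<alpha> t $ i" for i
      using min_pos_coeff[of \<alpha> t i] that \<epsilon>(1) by (simp add: \<kappa>_def field_simps)
    show "\<rho> * (\<alpha> t \<bullet> 1) \<le> r t"
      using facts(3) by (simp add: \<rho>_def)
    have "violation \<alpha> r q t \<le> total_violation \<alpha> r q"
      unfolding total_violation_def by (intro member_le_sum) (auto simp: violation_def)
    then show "\<alpha> t \<bullet> q - r t \<le> \<epsilon>"
      using total_violation_le[OF ne lam \<epsilon>(1) opt large] by (simp add: violation_def)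
  qed
  then have feasible: "q' \<in> constrained_probs G a b \<alpha> r"
    using sale' by (simp add: constrained_probs_def)
  have "penalized_value G a b c \<alpha> r lam - constrained_value G a b c \<alpha> r \<le>
      revenue G a b c q - revenue G a b c q'"
    using penalized_value_eq[OF opt] penalized_revenue_le_revenue[OF lam, of \<alpha> r q]
      revenue_le_constrained_value[OF feasible] by simp
  also have "\<dots> \<le> (\<Sum>i\<in>UNIV. (prices G a b q' $ i - c $ i) * (q $ i - q' $ i))"
    using expected_revenue_diff_le[of "prices G a b q'" "prices G a b q"] q'_le
    by (simp add: revenue_eq_expected_revenue sale sale' p_prices)
  also have "\<dots> \<le> (\<Sum>i\<in>(UNIV :: 'v set). B * \<kappa>)"
  proof (intro sum_mono)
    fix i
    show "(prices G a b q' $ i - c $ i) * (q $ i - q' $ i) \<le> B * \<kappa>"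
    \<comment> \<open>An unchanged probability may lie below \<open>\<delta>\<close>, where no price
      bound is available, but it contributes zero.\<close>
    proof (cases "q' $ i = q $ i")
      case True
      then show ?thesis
        using \<kappa> by (simp add: B_def)
    next
      case False
      then have "\<delta> \<le> q' $ i" and d: "q $ i - q' $ i \<le> \<kappa>"
        using \<kappa> by (auto simp: q'_def truncate_def min_def max_def split: if_splits)
      then have "prices G a b q' $ i \<le> max (a $ i / b $ i - 1 / (b $ i * l i) * ln (\<delta> / L i)) 0"
        using \<delta>(1) L l bound by (intro price_le) (auto simp: p_prices[OF sale'])
      also have "\<dots> \<le> B"
        unfolding B_def by (intro max.mono Max_ge) auto
      \<comment> \<open>With nonnegative costs the margin is at most the price.\<close>
      finally have "(prices G a b q' $ i - c $ i) * (q $ i - q' $ i) \<le> B * (q $ i - q' $ i)"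
        using c[of i] q'_le[of i] by (intro mult_right_mono) auto
      also have "\<dots> \<le> B * \<kappa>"
        by (intro mult_left_mono d) (simp add: B_def)
      finally show ?thesis .
    qed
  qed
  also have "\<dots> = B * (real CARD('v) * \<epsilon> / min_pos_coeff \<alpha>)"
    by (simp add: \<kappa>_def)
  finally have "\<bar>penalized_value G a b c \<alpha> r lam - constrained_value G a b c \<alpha> r\<bar> \<le>
      B * (real CARD('v) * \<epsilon> / min_pos_coeff \<alpha>)"
    using constrained_value_le_penalized_value[OF ne lam] by simp
  then show ?thesis
    using False by (simp add: gap_bound_def B_def \<delta>_def)
qed (simp add: gap_bound_def)

text \<open>As \<open>\<epsilon>\<close> tends to zero the slack tends to the positive
  \<open>min_ratio\<close>, so the logarithms converge and the first factor is eventually at most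
  \<open>B\<close>; the second factor is linear in \<open>\<epsilon>\<close>.\<close>

lemma gap_bound_linear:
  fixes \<alpha> :: "'t::finite \<Rightarrow> real^'v::finite"
  assumes L: "\<And>i. 0 < L i" and \<mu>: "0 < min_pos_coeff \<alpha>" and \<rho>: "0 < min_ratio \<alpha> r"
  shows "\<exists>K. \<forall>\<^sub>F \<epsilon> in at_right 0. 0 \<le> gap_bound a b L l \<alpha> r \<epsilon> \<and> gap_bound a b L l \<alpha> r \<epsilon> \<le> ereal (K * \<epsilon>)"
proof
  define f where "f i \<epsilon> = a $ i / b $ i - 1 / (b $ i * l i) * ln (slack \<alpha> r \<epsilon> / L i)" for i \<epsilon>
  define B where "B = max (Max (range (\<lambda>i. f i 0)) + 1) 0"
  have slack_0: "slack \<alpha> r 0 = min_ratio \<alpha> r"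
    by (simp add: slack_def)
  have "((\<lambda>\<epsilon>. min_ratio \<alpha> r - \<epsilon> / min_pos_coeff \<alpha>) \<longlongrightarrow>
      min_ratio \<alpha> r - 0 / min_pos_coeff \<alpha>) (at_right 0)"
    using \<mu> by (intro tendsto_intros) auto
  then have slack: "(slack \<alpha> r \<longlongrightarrow> slack \<alpha> r 0) (at_right 0)"
    by (simp add: slack_def[abs_def])
  have "(f i \<longlongrightarrow> f i 0) (at_right 0)" for i
    unfolding f_def using L[of i] \<rho> by (intro tendsto_intros slack) (auto simp: slack_0)
  then have "\<forall>\<^sub>F \<epsilon> in at_right 0. f i \<epsilon> < f i 0 + 1" for i
    by (rule order_tendstoD) simp
  then have "\<forall>\<^sub>F \<epsilon> in at_right 0. \<forall>i. f i \<epsilon> < f i 0 + 1"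
    by (rule eventually_all_finite)
  moreover have "\<forall>\<^sub>F \<epsilon> in at_right 0. 0 < slack \<alpha> r \<epsilon>"
    using slack \<rho> by (intro order_tendstoD) (auto simp: slack_0)
  moreover have "\<forall>\<^sub>F \<epsilon> in at_right 0. (0::real) < \<epsilon>"
    by (rule eventually_at_right_less)
  ultimately show "\<forall>\<^sub>F \<epsilon> in at_right 0. 0 \<le> gap_bound a b L l \<alpha> r \<epsilon> \<and>
      gap_bound a b L l \<alpha> r \<epsilon> \<le> ereal (B * real CARD('v) / min_pos_coeff \<alpha> * \<epsilon>)"
  proof eventually_elim
    case (elim \<epsilon>)
    have "f i \<epsilon> \<le> Max (range (\<lambda>i. f i 0)) + 1" for i
    proof -
      have "f i \<epsilon> < f i 0 + 1"
        using elim(1) by blast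
      also have "f i 0 \<le> Max (range (\<lambda>i. f i 0))"
        by (intro Max_ge) auto
      finally show ?thesis
        by simp
    qed
    then have "max (Max (range (\<lambda>i. f i \<epsilon>))) 0 \<le> B"
      unfolding B_def by (intro max.mono) auto
    then have "max (Max (range (\<lambda>i. f i \<epsilon>))) 0 * (real CARD('v) * \<epsilon> / min_pos_coeff \<alpha>) \<le>
        B * (real CARD('v) * \<epsilon> / min_pos_coeff \<alpha>)"
      using elim(3) \<mu> by (intro mult_right_mono) auto
    moreover have "0 \<le> max (Max (range (\<lambda>i. f i \<epsilon>))) 0 * (real CARD('v) * \<epsilon> / min_pos_coeff \<alpha>)"
      using elim(3) \<mu> by (intro mult_nonneg_nonneg) auto
    ultimately show ?case
      using elim(2) by (simp add: gap_bound_def f_def mult_ac)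
  qed
qed

lemma gap_bound_tendsto_0:
  assumes "\<forall>\<^sub>F \<epsilon> in at_right 0. 0 \<le> gap_bound a b L l \<alpha> r \<epsilon> \<and> gap_bound a b L l \<alpha> r \<epsilon> \<le> ereal (K * \<epsilon>)"
  shows "(gap_bound a b L l \<alpha> r \<longlongrightarrow> 0) (at_right 0)"
proof (rule tendsto_sandwich[where f = "\<lambda>_. 0" and h = "\<lambda>\<epsilon>. ereal (K * \<epsilon>)"])
  have "((\<lambda>\<epsilon>. K * \<epsilon>) \<longlongrightarrow> K * 0) (at_right 0)"
    by (intro tendsto_intros)
  then show "((\<lambda>\<epsilon>. ereal (K * \<epsilon>)) \<longlongrightarrow> 0) (at_right 0)"
    by (simp add: zero_ereal_def)
qed (use assms in \<open>auto elim: eventually_mono\<close>)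

text \<open>The two objectives differ by \<open>\<epsilon>\<close> times the total violation, so
  adding the two optimality inequalities cancels the rest.\<close>

lemma total_violation_antimono:
  assumes "penalized_optimal G a b c \<alpha> r lam1 q1" "penalized_optimal G a b c \<alpha> r lam2 q2"
    and lam: "lam1 - lam2 = \<epsilon> *\<^sub>R 1" and \<epsilon>: "0 < \<epsilon>"
  shows "total_violation \<alpha> r q1 \<le> total_violation \<alpha> r q2"
proof -
  have "lam1 $ t = lam2 $ t + \<epsilon>" for t
    using lam by (simp add: vec_eq_iff algebra_simps)
  then have "penalized_revenue G a b c \<alpha> r lam1 q =
      penalized_revenue G a b c \<alpha> r lam2 q - \<epsilon> * total_violation \<alpha> r q" for q
    by (simp add: penalized_revenue_def total_violation_def distrib_right sum.distrib sum_distrib_left)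
  moreover have "penalized_revenue G a b c \<alpha> r lam1 q2 \<le> penalized_revenue G a b c \<alpha> r lam1 q1"
    "penalized_revenue G a b c \<alpha> r lam2 q1 \<le> penalized_revenue G a b c \<alpha> r lam2 q2"
    using assms(1,2) by (auto simp: penalized_optimal_def is_arg_max_def not_less)
  ultimately have "\<epsilon> * total_violation \<alpha> r q1 \<le> \<epsilon> * total_violation \<alpha> r q2"
    by simp
  then show ?thesis
    using \<epsilon> by simp
qed

section \<open>From the partitioned model to the pair \<open>G\<close>, \<open>W\<close>\<close>

lemma partitioned_gev_pricing:
  fixes V :: "'n::finite \<Rightarrow> 'v::finite set"
  assumes model: "partitioned_gev V Gn G b"
  obtains W where "gev_pricing G W b"
proof -
  have disj: "disjoint_family V" and cover: "(\<Union>n. V n) = UNIV" and cpgf: "cpgf_on (V n) (Gn n)"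
    and G: "\<And>Y. Y \<in> pos_orthant \<Longrightarrow> G Y = (\<Sum>n\<in>UNIV. Gn n Y)" and b: "0 < b $ i"
    and b_eq: "i \<in> V n \<Longrightarrow> j \<in> V n \<Longrightarrow> b $ i = b $ j" for n i j
    using model unfolding partitioned_gev_def by blast+
  \<comment> \<open>Any member of the block will do, as \<open>b\<close> is constant on it.\<close>
  define \<beta> where "\<beta> n = b $ (SOME i. i \<in> V n)" for n
  have \<beta>: "\<beta> n = b $ i" if "i \<in> V n" for n i
    unfolding \<beta>_def by (rule b_eq[OF _ that]) (use that in \<open>rule someI\<close>)
  have \<beta>_pos: "0 < \<beta> n" for n
    using b by (simp add: \<beta>_def)
  define W where "W Y = (\<Sum>n\<in>UNIV. (1 / \<beta> n) * Gn n Y)" for Y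
  have sub: "substitutable (Gn n)" for n
    using cpgf by (rule cpgf_on_substitutable)
  \<comment> \<open>With arbitrary weights this serves both \<open>G\<close> and \<open>W\<close>:
    only the block containing \<open>i\<close> contributes to the derivative.\<close>
  have partial_sum: "partial i F Y = w n * partial i (Gn n) Y"
    if "i \<in> V n" "Y \<in> pos_orthant" "\<And>Z. Z \<in> pos_orthant \<Longrightarrow> F Z = (\<Sum>n\<in>UNIV. w n * Gn n Z)"
    for i n Y F w
  proof -
    have "i \<notin> V k" if "k \<noteq> n" for k
      using disjoint_family_onD[OF disj, of k n] that \<open>i \<in> V n\<close> by auto
    then have "partial i (Gn k) Y = 0" if "k \<noteq> n" for k
      using cpgf_on_partial_eq_0[OF cpgf \<open>Y \<in> pos_orthant\<close>] that by blast
    moreover have "partial i F Y = (\<Sum>k\<in>UNIV. w k * partial i (Gn k) Y)"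
      using substitutable.differentiable[OF sub that(2)] that(2,3) by (rule partial_weighted_sum(2))
    ultimately show ?thesis
      by (simp add: sum.remove[of UNIV n])
  qed
  have "gev_pricing G W b"
  proof (intro gev_pricing.intro gev_pricing_axioms.intro)
    show "substitutable G"
      by (rule substitutable_weighted_sum[OF sub, where w = "\<lambda>_. 1"]) (simp_all add: G)
    show "substitutable W"
      by (rule substitutable_weighted_sum[OF sub, where w = "\<lambda>n. 1 / \<beta> n"])
        (use \<beta>_pos in \<open>simp_all add: W_def less_imp_le\<close>)
    show "0 < b $ i" for i
      by (rule b)
    fix i and Y :: "real^'v" assume Y: "Y \<in> pos_orthant"
    obtain n where n: "i \<in> V n"
      using cover by blast
    have "partial i G Y = partial i (Gn n) Y"
      using partial_sum[OF n Y, of G "\<lambda>_. 1"] G by simp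
    moreover have "partial i W Y = 1 / \<beta> n * partial i (Gn n) Y"
      using n Y by (rule partial_sum) (simp add: W_def)
    ultimately show "0 < partial i G Y" and "partial i W Y = partial i G Y / b $ i"
      using cpgf_on_partial_pos[OF cpgf Y n] \<beta>[OF n] by simp_all
  qed
  then show ?thesis
    by (rule that)
qed

theorem theorem7:
  fixes V :: "'n::finite \<Rightarrow> 'v::finite set"
    and Gn :: "'n \<Rightarrow> real^'v \<Rightarrow> real"
    and G :: "real^'v \<Rightarrow> real"
    and a b c :: "real^'v"
    and \<alpha> :: "'t::finite \<Rightarrow> real^'v"
    and r :: "'t \<Rightarrow> real"
  assumes model: "partitioned_gev V Gn G b"
  defines "vstar \<equiv> constrained_value G a b c \<alpha> r"
    and "v \<equiv> penalized_value G a b c \<alpha> r"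
    and "opt \<equiv> penalized_optimal G a b c \<alpha> r"
    and "\<Delta> \<equiv> unconstrained_value G a b c"
  shows
    "(\<forall>\<epsilon>>0. \<forall>lam1 lam2 :: real^'t. \<forall>p1 p2.
        (\<forall>t. 0 \<le> lam1 $ t) \<and> (\<forall>t. 0 \<le> lam2 $ t) \<and> lam1 - lam2 = \<epsilon> *\<^sub>R 1 \<and>
        opt lam1 p1 \<and> opt lam2 p2 \<longrightarrow>
        total_violation \<alpha> r p1 \<le> total_violation \<alpha> r p2)
     \<and>
     (constrained_probs G a b \<alpha> r \<noteq> {} \<longrightarrow>
      (\<forall>lam. (\<forall>t. 0 \<le> lam $ t) \<longrightarrow> vstar \<le> v lam) \<and>
      (\<forall>\<epsilon>>0. \<forall>lam p.
        (\<forall>t. 0 \<le> lam $ t) \<and> opt lam p \<and> (\<Delta> - vstar) / \<epsilon> \<le> Min (range (\<lambda>t. lam $ t)) \<longrightarrow>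
        total_violation \<alpha> r p \<le> \<epsilon>))
     \<and>
     (\<forall>L l :: 'v \<Rightarrow> real.
        (\<forall>i. 0 < L i \<and> 0 < l i) \<and>
        (\<forall>x. (\<forall>i. 0 \<le> x $ i) \<longrightarrow>
           (\<forall>i. attraction a b x $ i * partial i G (attraction a b x)
                  \<le> L i * (attraction a b x $ i) powr l i)) \<longrightarrow>
        ((\<forall>i. 0 \<le> c $ i) \<and> (\<forall>t i. 0 \<le> \<alpha> t $ i) \<longrightarrow>
         (\<forall>\<epsilon>>0. \<epsilon> \<le> min_pos_coeff \<alpha> * min_ratio \<alpha> r \<longrightarrow>
           (\<forall>lam p. (\<forall>t. 0 \<le> lam $ t) \<and> opt lam p \<and>
              (\<Delta> - vstar) / \<epsilon> \<le> Min (range (\<lambda>t. lam $ t)) \<longrightarrow>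
              ereal \<bar>v lam - vstar\<bar> \<le> gap_bound a b L l \<alpha> r \<epsilon>))) \<and>
        ((\<exists>t i. 0 < \<alpha> t $ i) \<and> 0 < min_ratio \<alpha> r \<longrightarrow>
           (gap_bound a b L l \<alpha> r \<longlongrightarrow> 0) (at_right 0) \<and>
           (\<exists>K. \<forall>\<^sub>F \<epsilon> in at_right 0. gap_bound a b L l \<alpha> r \<epsilon> \<le> ereal (K * \<epsilon>))))"
proof -
  obtain W where "gev_pricing G W b"
    by (rule partitioned_gev_pricing[OF model])
  then interpret gev_pricing G W a b c .
  have limit: "(gap_bound a b L l \<alpha> r \<longlongrightarrow> 0) (at_right 0) \<and>
      (\<exists>K. \<forall>\<^sub>F \<epsilon> in at_right 0. gap_bound a b L l \<alpha> r \<epsilon> \<le> ereal (K * \<epsilon>))"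
    if "\<forall>i. 0 < L i \<and> 0 < l i" "(\<exists>t i. 0 < \<alpha> t $ i) \<and> 0 < min_ratio \<alpha> r" for L l
  proof -
    have "\<And>i. 0 < L i" "0 < min_pos_coeff \<alpha>" "0 < min_ratio \<alpha> r"
      using that min_pos_coeff(1) by blast+
    then obtain K where K: "\<forall>\<^sub>F \<epsilon> in at_right 0.
        0 \<le> gap_bound a b L l \<alpha> r \<epsilon> \<and> gap_bound a b L l \<alpha> r \<epsilon> \<le> ereal (K * \<epsilon>)"
      using gap_bound_linear[of L \<alpha> r a b l] by blast
    then have "\<forall>\<^sub>F \<epsilon> in at_right 0. gap_bound a b L l \<alpha> r \<epsilon> \<le> ereal (K * \<epsilon>)"
      by (rule eventually_mono) simp
    then show ?thesis
      using gap_bound_tendsto_0[OF K] by blast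
  qed
  show ?thesis
  proof (intro conjI allI impI)
    show "total_violation \<alpha> r p1 \<le> total_violation \<alpha> r p2"
      if "0 < \<epsilon>" "(\<forall>t. 0 \<le> lam1 $ t) \<and> (\<forall>t. 0 \<le> lam2 $ t) \<and> lam1 - lam2 = \<epsilon> *\<^sub>R 1 \<and>
        opt lam1 p1 \<and> opt lam2 p2" for \<epsilon> lam1 lam2 p1 p2
      using that unfolding opt_def by (blast intro: total_violation_antimono)
    show "vstar \<le> v lam" if "constrained_probs G a b \<alpha> r \<noteq> {}" "\<forall>t. 0 \<le> lam $ t" for lam
      using that unfolding vstar_def v_def by (blast intro: constrained_value_le_penalized_value)
    show "total_violation \<alpha> r q \<le> \<epsilon>"
      if "constrained_probs G a b \<alpha> r \<noteq> {}" "0 < \<epsilon>"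
        "(\<forall>t. 0 \<le> lam $ t) \<and> opt lam q \<and> (\<Delta> - vstar) / \<epsilon> \<le> Min (range (\<lambda>t. lam $ t))" for \<epsilon> lam q
      using that unfolding vstar_def opt_def \<Delta>_def by (blast intro: total_violation_le)
    show "ereal \<bar>v lam - vstar\<bar> \<le> gap_bound a b L l \<alpha> r \<epsilon>"
      if "(\<forall>i. 0 < L i \<and> 0 < l i) \<and>
        (\<forall>x. (\<forall>i. 0 \<le> x $ i) \<longrightarrow>
          (\<forall>i. attraction a b x $ i * partial i G (attraction a b x) \<le> L i * (attraction a b x $ i) powr l i))"
        "(\<forall>i. 0 \<le> c $ i) \<and> (\<forall>t i. 0 \<le> \<alpha> t $ i)" "0 < \<epsilon>" "\<epsilon> \<le> min_pos_coeff \<alpha> * min_ratio \<alpha> r"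
        "(\<forall>t. 0 \<le> lam $ t) \<and> opt lam q \<and> (\<Delta> - vstar) / \<epsilon> \<le> Min (range (\<lambda>t. lam $ t))"
      for L l \<epsilon> lam q
      using that unfolding vstar_def v_def opt_def \<Delta>_def
      by (intro value_gap_le[where q = q]) (simp_all add: weight_def)
  qed (use limit in blast)+
qed

end
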